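(* Let $R$ be a Dedekind domain and let $P$, $Q$, $M$ be nonzero ideals of $R$ such that $P$ and $Q$ are prime, $M\not\subseteq Q$, $R/P$ and $R/M$ are finite and nontrivial, and $|R/Q|=2$. Let $\alpha$ be a positive integer. Then \[s'(G_{R/P^{\alpha}})=\tfrac12|R/P|^{\alpha}\varphi(R/P^{\alpha})=\tfrac12|R/P|^{2\alpha-1}(|R/P|-1)\] and \[s'(G_{R/QM})\le\tfrac12|R/M|\,\varphi(R/M).\]
   Context: For an ideal $I$ with $R/I$ finite, $G_{R/I}$ is the unitary Cayley graph of $R/I$: vertex set $R/I$, with $a+I$, $b+I$ adjacent iff $a-b+I$ is a unit of $R/I$; $\varphi(R/I)$ is the number of units of $R/I$. An edge coloring is strong if any two distinct edges having adjacent endpoints receive different colors; the strong chromatic index $s'(G)$ is the least number of colors in a strong edge coloring of $G$. *)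

theory Defs
  imports "HOL-Algebra.Algebra"
begin

text \<open>A Dedekind domain is an integral domain in which every nonzero proper ideal is a product of
  prime ideals. Fields satisfy the condition vacuously.\<close>

locale dedekind_domain = domain R for R (structure) +
  assumes prime_ideal_factorization:
    "ideal I R \<Longrightarrow> I \<noteq> {\<zero>} \<Longrightarrow> I \<noteq> carrier R \<Longrightarrow>
      \<exists>Ps. (\<forall>P \<in> set Ps. primeideal P R) \<and> I = foldr (ideal_prod R) Ps (carrier R)"

definition ideal_power :: "('a, 'b) ring_scheme \<Rightarrow> 'a set \<Rightarrow> nat \<Rightarrow> 'a set"
  where "ideal_power R I n = I [^]\<^bsub>ideals_set R\<^esub> n"

definition quot_card :: "('a, 'b) ring_scheme \<Rightarrow> 'a set \<Rightarrow> nat"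
  where "quot_card R I = card (carrier (R Quot I))"

definition quot_phi :: "('a, 'b) ring_scheme \<Rightarrow> 'a set \<Rightarrow> nat"
  where "quot_phi R I = card (Units (R Quot I))"

text \<open>An undirected graph is a pair of a vertex set and an edge set; the edge joining \<open>u\<close> and \<open>v\<close>
  is the unordered pair \<open>{u, v}\<close>.\<close>

type_synonym 'v ugraph = "'v set \<times> 'v set set"

abbreviation vertices :: "'v ugraph \<Rightarrow> 'v set"
  where "vertices G \<equiv> fst G"

abbreviation edges :: "'v ugraph \<Rightarrow> 'v set set"
  where "edges G \<equiv> snd G"

definition adjacent :: "'v ugraph \<Rightarrow> 'v \<Rightarrow> 'v \<Rightarrow> bool"
  where "adjacent G u v \<longleftrightarrow> u \<in> vertices G \<and> v \<in> vertices G \<and> {u, v} \<in> edges G"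

text \<open>If \<open>R Quot I\<close> is nontrivial then \<open>0\<close> is not a unit, so the graph has no loops. The condition
  is symmetric in \<open>a\<close> and \<open>b\<close> because the units are closed under negation.\<close>

definition unitary_cayley_graph :: "('a, 'b) ring_scheme \<Rightarrow> 'a set \<Rightarrow> 'a set ugraph"
  where "unitary_cayley_graph R I =
    (carrier (R Quot I),
     {{I +>\<^bsub>R\<^esub> a, I +>\<^bsub>R\<^esub> b} | a b.
        a \<in> carrier R \<and> b \<in> carrier R \<and> I +>\<^bsub>R\<^esub> (a \<ominus>\<^bsub>R\<^esub> b) \<in> Units (R Quot I)})"

text \<open>Two distinct edges \<open>{u, v}\<close> and \<open>{u, w}\<close> sharing an endpoint have the adjacent endpoints
  \<open>v\<close> and \<open>u\<close>, so a strong edge coloring is in particular a proper one.\<close>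

definition strong_edge_coloring :: "'v ugraph \<Rightarrow> ('v set \<Rightarrow> 'c) \<Rightarrow> bool"
  where "strong_edge_coloring G c \<longleftrightarrow>
    (\<forall>e \<in> edges G. \<forall>f \<in> edges G.
       e \<noteq> f \<and> (\<exists>u \<in> e. \<exists>v \<in> f. adjacent G u v) \<longrightarrow> c e \<noteq> c f)"

text \<open>Meaningful if some strong edge coloring with finitely many colors exists, in particular for
  every graph with finitely many edges.\<close>

definition strong_chromatic_index :: "'v ugraph \<Rightarrow> nat"
  where "strong_chromatic_index G =
    (LEAST k. \<exists>c :: 'v set \<Rightarrow> nat. strong_edge_coloring G c \<and> c ` edges G \<subseteq> {..<k})"

end

theory Submission
  imports Defs
begin

text \<open>A prime \<open>P\<close> is cancellable as a factor of ideals, so the powers of \<open>P\<close> strictly decrease; as every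
  ideal is a product of primes, none lies strictly between \<open>P\<^sup>n\<close> and \<open>P\<^sup>n\<^sup>+\<^sup>1\<close>, and \<open>P\<^sup>n / P\<^sup>n\<^sup>+\<^sup>1\<close> is
  a line over \<open>R Quot P\<close>. This gives the numbers of elements and of units of \<open>R Quot P\<^sup>\<alpha>\<close>. Its
  graph is complete multipartite with the cosets of \<open>P\<close> as parts, so any two edges have adjacent
  endpoints and each edge needs its own colour. For \<open>Q \<cdot> M\<close>, an edge is coloured by its image in
  the graph of \<open>R Quot M\<close>.\<close>

section \<open>Products of ideals and primes modulo a prime\<close>

text \<open>Only the existence of prime factorizations is assumed, so the cancellability of a
  nonzero prime \<open>P\<close> must be derived from it (Matusita's theorem). The obstacle is that
  \<open>P\<close> itself does not visibly divide a principal ideal. Factoring (x) for a nonzero x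
  in \<open>P\<close> yields a prime p inside \<open>P\<close> that does divide one and can
  therefore be cancelled; what remains is that p is maximal, so that p = \<open>P\<close>. This
  amounts to comparing factorizations of (b)^2 and (b^2) in R/p, but factorizations are available in
  R only. Hence statements about R/p are phrased with ideals of R up to adding p, and one
  cancellation lemma serves both for the zero prime and for p.\<close>

no_notation Sum_Type.Plus (infixr \<open><+>\<close> 65)

lemma ideal_prod_mono:
  assumes "I \<subseteq> I'" "J \<subseteq> J'"
  shows "ideal_prod R I J \<subseteq> ideal_prod R I' J'"
proof
  fix s assume "s \<in> ideal_prod R I J"
  then show "s \<in> ideal_prod R I' J'"
    by (induct rule: ideal_prod.induct) (use assms in \<open>auto intro: ideal_prod.intros\<close>)
qed

lemma set_add_memE:
  assumes "x \<in> I <+>\<^bsub>R\<^esub> J"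
  obtains i j where "i \<in> I" "j \<in> J" "x = i \<oplus>\<^bsub>R\<^esub> j"
  using assms by (auto simp: set_add_def')

lemma set_add_memI:
  assumes "i \<in> I" "j \<in> J" "x = i \<oplus>\<^bsub>R\<^esub> j"
  shows "x \<in> I <+>\<^bsub>R\<^esub> J"
  using assms by (auto simp: set_add_def')

abbreviation ideal_list_prod :: "('a, 'b) ring_scheme \<Rightarrow> 'a set list \<Rightarrow> 'a set"
  where "ideal_list_prod R Is \<equiv> foldr (ideal_prod R) Is (carrier R)"

context cring
begin

lemma ideal_zero: "ideal I R \<Longrightarrow> \<zero> \<in> I"
  by (simp add: additive_subgroup.zero_closed ideal.axioms(1))

lemma ideal_add: "ideal I R \<Longrightarrow> a \<in> I \<Longrightarrow> b \<in> I \<Longrightarrow> a \<oplus> b \<in> I"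
  by (simp add: additive_subgroup.a_closed ideal.axioms(1))

lemma ideal_neg: "ideal I R \<Longrightarrow> a \<in> I \<Longrightarrow> \<ominus> a \<in> I"
  by (simp add: additive_subgroup.a_inv_closed ideal.axioms(1))

lemma ideal_minus: "ideal I R \<Longrightarrow> a \<in> I \<Longrightarrow> b \<in> I \<Longrightarrow> a \<ominus> b \<in> I"
  by (simp add: a_minus_def ideal_add ideal_neg)

lemma set_add_upper:
  assumes "ideal I R" "ideal J R"
  shows "I \<subseteq> I <+> J" "J \<subseteq> I <+> J"
proof -
  show "I \<subseteq> I <+> J"
  proof
    fix x assume "x \<in> I"
    then show "x \<in> I <+> J"
      using assms by (intro set_add_memI[of x _ \<zero>]) (auto simp: ideal_zero dest: ideal.Icarr)
  qed
  show "J \<subseteq> I <+> J"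
  proof
    fix x assume "x \<in> J"
    then show "x \<in> I <+> J"
      using assms by (intro set_add_memI[of \<zero> _ x]) (auto simp: ideal_zero dest: ideal.Icarr)
  qed
qed

lemma set_add_least:
  assumes "ideal K R" "I \<subseteq> K" "J \<subseteq> K"
  shows "I <+> J \<subseteq> K"
  using assms by (auto elim!: set_add_memE intro!: ideal_add)

lemma ideal_list_prod_ideal:
  assumes "\<forall>I \<in> set Is. ideal I R"
  shows "ideal (ideal_list_prod R Is) R"
  using assms by (induct Is) (auto intro: oneideal ideal_prod_is_ideal)

lemma ideal_list_prod_append:
  assumes "\<forall>I \<in> set Is \<union> set Js. ideal I R"
  shows "ideal_list_prod R (Is @ Js) = ideal_list_prod R Is \<cdot> ideal_list_prod R Js"
  using assms
proof (induct Is)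
  case Nil
  then show ?case
    using ideal_prod_one[of "ideal_list_prod R Js"] ideal_list_prod_ideal[of Js]
      ideal_prod_commute[OF oneideal, of "ideal_list_prod R Js"] by simp
next
  case (Cons I Is)
  then show ?case
    using ideal_prod_assoc[of I] ideal_list_prod_ideal[of Is] ideal_list_prod_ideal[of Js] by simp
qed

text \<open>Any factor can be moved to the front, so the lists act as multisets. The rest of the
  list is the complementary factor that cancellation asks for.\<close>

lemma ideal_list_prod_remove1:
  assumes "\<forall>I \<in> set Is. ideal I R" "A \<in> set Is"
  shows "ideal_list_prod R Is = A \<cdot> ideal_list_prod R (remove1 A Is)"
  using assms
proof (induct Is)
  case Nil
  then show ?case by simp
next
  case (Cons I Is)
  show ?case
  proof (cases "I = A")
    case True
    then show ?thesis by simp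
  next
    case False
    then have A: "A \<in> set Is" using Cons by simp
    have id: "ideal I R" "ideal A R" "ideal (ideal_list_prod R (remove1 A Is)) R"
      using Cons.prems A by (auto intro!: ideal_list_prod_ideal dest: notin_set_remove1 set_remove1_subset[THEN subsetD])
    have "ideal_list_prod R (I # Is) = I \<cdot> (A \<cdot> ideal_list_prod R (remove1 A Is))"
      using Cons A by simp
    also have "\<dots> = A \<cdot> (I \<cdot> ideal_list_prod R (remove1 A Is))"
      using id by (metis ideal_prod_assoc ideal_prod_commute)
    finally show ?thesis using False by simp
  qed
qed

lemma ideal_list_prod_subset:
  assumes "\<forall>I \<in> set Is. ideal I R" "A \<in> set Is"
  shows "ideal_list_prod R Is \<subseteq> A"
proof -
  have "ideal (ideal_list_prod R (remove1 A Is)) R"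
    using assms by (auto intro!: ideal_list_prod_ideal dest: set_remove1_subset[THEN subsetD])
  then show ?thesis
    using ideal_prod_inter[of A "ideal_list_prod R (remove1 A Is)"] assms
    by (auto simp: ideal_list_prod_remove1[OF assms])
qed

lemma prime_contains_factor:
  assumes "primeideal P R" "\<forall>I \<in> set Is. ideal I R" "ideal_list_prod R Is \<subseteq> P"
  shows "\<exists>A \<in> set Is. A \<subseteq> P"
  using assms(2,3)
proof (induct Is)
  case Nil
  then show ?case
    using assms(1) by (metis foldr_Nil id_apply ideal.Icarr primeideal.I_notcarr primeideal_def subsetI subset_antisym)
next
  case (Cons I Is)
  then show ?case
    using primeideal_divides_ideal_prod[OF assms(1), of I "ideal_list_prod R Is"]
      ideal_list_prod_ideal[of Is] by auto
qed

section \<open>Cancelling an ideal factor modulo a prime\<close>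

lemma cgenideal_memE:
  assumes "x \<in> PIdl b"
  obtains r where "r \<in> carrier R" "x = r \<otimes> b"
  using assms by (auto simp: cgenideal_def)

text \<open>As (b) has a single generator, the multiples of b in a sum of products collect into one
  term b y. Later b is cancelled from this term to get hold of y.\<close>

lemma prod_with_principal_sum:
  assumes "ideal p R" "b \<in> carrier R" "ideal I R" "t \<in> (p <+> PIdl b) \<cdot> I"
  obtains q y where "q \<in> p \<cdot> I" "y \<in> I" "t = q \<oplus> b \<otimes> y"
proof -
  have id: "ideal (p \<cdot> I) R" using assms ideal_prod_is_ideal by blast
  note carr [simp] = ideal.Icarr[OF assms(1)] ideal.Icarr[OF assms(3)] ideal.Icarr[OF id] \<open>b \<in> carrier R\<close>
  have "\<exists>q y. q \<in> p \<cdot> I \<and> y \<in> I \<and> t = q \<oplus> b \<otimes> y"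
    using assms(4)
  proof (induct rule: ideal_prod.induct)
    case (prod j i)
    then obtain q r where "q \<in> p" "r \<in> carrier R" "j = q \<oplus> r \<otimes> b"
      by (metis set_add_memE cgenideal_memE)
    moreover from this have "j \<otimes> i = q \<otimes> i \<oplus> b \<otimes> (r \<otimes> i)"
      using prod by (simp add: l_distr m_assoc m_lcomm[of r])
    ultimately show ?case
      using prod ideal_prod.prod[of q p i I R] ideal.I_l_closed[OF assms(3)] by blast
  next
    case (sum s1 s2)
    then obtain q1 y1 q2 y2 where *: "q1 \<in> p \<cdot> I" "y1 \<in> I" "s1 = q1 \<oplus> b \<otimes> y1"
      "q2 \<in> p \<cdot> I" "y2 \<in> I" "s2 = q2 \<oplus> b \<otimes> y2"
      by blast
    have c: "q1 \<in> carrier R" "q2 \<in> carrier R" "y1 \<in> carrier R" "y2 \<in> carrier R"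
      using * by simp_all
    have "s1 \<oplus> s2 = (q1 \<oplus> q2) \<oplus> b \<otimes> (y1 \<oplus> y2)"
      unfolding *(3,6) using c \<open>b \<in> carrier R\<close> by algebra
    then show ?case
      using * ideal_add[OF assms(3)] ideal_add[OF id] by blast
  qed
  then show thesis using that by blast
qed

text \<open>A factor of a nonzero principal ideal of a domain can be cancelled; this is that fact
  read in R/p, where p + (b) becomes principal. Multiplying the inclusion by \<open>C\<close> gives
  b x = b y modulo p with y in \<open>J\<close>, and the prime p lets b be cancelled.\<close>

lemma cancel_factor:
  assumes p: "primeideal p R" and b: "b \<in> carrier R" "b \<notin> p"
    and id: "ideal A R" "ideal C R" "ideal I R" "ideal J R"
    and AC: "A \<cdot> C = p <+> PIdl b"
    and sub: "A \<cdot> I \<subseteq> A \<cdot> J <+> p"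
  shows "I \<subseteq> J <+> p"
proof
  fix x assume x: "x \<in> I"
  have ip: "ideal p R" using p by (rule primeideal.axioms)
  have b': "b \<in> A \<cdot> C"
    unfolding AC using set_add_upper(2)[OF ip cgenideal_ideal] cgenideal_self b by blast
  have "b \<otimes> x \<in> (A \<cdot> C) \<cdot> I"
    using b' x by (rule ideal_prod.prod)
  also have "(A \<cdot> C) \<cdot> I = C \<cdot> (A \<cdot> I)"
    using id by (simp add: ideal_prod_commute[of A C] ideal_prod_assoc)
  also have "\<dots> \<subseteq> C \<cdot> (A \<cdot> J <+> p)"
    using sub by (intro ideal_prod_mono) auto
  also have "\<dots> = (C \<cdot> (A \<cdot> J)) <+> (C \<cdot> p)"
    using id ip ideal_prod_is_ideal by (intro ideal_prod_r_distr) auto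
  also have "C \<cdot> (A \<cdot> J) = (p <+> PIdl b) \<cdot> J"
    using id by (simp flip: AC add: ideal_prod_commute[of A C] ideal_prod_assoc)
  finally obtain s t where st: "s \<in> (p <+> PIdl b) \<cdot> J" "t \<in> C \<cdot> p" "b \<otimes> x = s \<oplus> t"
    by (rule set_add_memE)
  obtain q y where qy: "q \<in> p \<cdot> J" "y \<in> J" "s = q \<oplus> b \<otimes> y"
    using prod_with_principal_sum[OF ip b(1) id(4) st(1)] .
  have qt: "q \<in> p" "t \<in> p"
    using ideal_prod_inter[OF ip id(4)] ideal_prod_inter[OF id(2) ip] qy st by auto
  have c: "x \<in> carrier R" "y \<in> carrier R" "q \<in> carrier R" "t \<in> carrier R"
    using x qy qt id ip by (auto dest: ideal.Icarr)
  have "b \<otimes> (x \<ominus> y) = b \<otimes> x \<ominus> b \<otimes> y"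
    using c b by algebra
  also have "\<dots> = q \<oplus> t"
    unfolding st(3) qy(3) using c b by algebra
  finally have "b \<otimes> (x \<ominus> y) \<in> p" using qt ideal_add[OF ip] by simp
  then have "x \<ominus> y \<in> p"
    using primeideal.I_prime[OF p, of b "x \<ominus> y"] b c by auto
  moreover have "x = y \<oplus> (x \<ominus> y)" using c by algebra
  ultimately show "x \<in> J <+> p" using qy by (auto intro: set_add_memI)
qed

text \<open>The usual uniqueness proof for cancellable prime factors, carried out in R/p.
  Cancellation is demanded of \<open>As\<close> alone, since each matched factor of
  \<open>Bs\<close> is one of these. An equality modulo p yields one in R because the two lists turn
  out to be permutations of each other.\<close>

lemma prime_factors_unique_mod:
  assumes p: "ideal p R"
    and "\<forall>A \<in> set As. primeideal A R \<and> p \<subseteq> A"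
    and "\<forall>B \<in> set Bs. primeideal B R \<and> p \<subseteq> B"
    and "\<And>A I J. A \<in> set As \<Longrightarrow> ideal I R \<Longrightarrow> ideal J R \<Longrightarrow> A \<cdot> I \<subseteq> A \<cdot> J <+> p \<Longrightarrow> I \<subseteq> J <+> p"
    and "ideal_list_prod R As <+> p = ideal_list_prod R Bs <+> p"
  shows "ideal_list_prod R As = ideal_list_prod R Bs"
  using assms(2-)
proof (induct "length As" arbitrary: As Bs)
  case 0
  \<comment> \<open>Otherwise the whole ring, being the empty product, would lie in a prime factor
    from \<open>Bs\<close>.\<close>
  have "Bs = []"
  proof (rule ccontr)
    assume "Bs \<noteq> []"
    then obtain B where B: "B \<in> set Bs" by (cases Bs) auto
    have iB: "\<forall>B \<in> set Bs. ideal B R" using 0 by (auto dest: primeideal.axioms)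
    have "carrier R \<subseteq> ideal_list_prod R Bs <+> p"
      using 0 set_add_upper(1)[OF oneideal p] by simp
    also have "\<dots> \<subseteq> B"
      using B 0 iB ideal_list_prod_subset[OF iB B] by (intro set_add_least) auto
    finally show False
      using B 0 iB by (metis ideal.Icarr primeideal.I_notcarr subsetI subset_antisym)
  qed
  then show ?case using 0 by simp
next
  case (Suc n)
  have iA: "\<forall>A \<in> set As. ideal A R" and iB: "\<forall>B \<in> set Bs. ideal B R"
    using Suc by (auto dest: primeideal.axioms)
  \<comment> \<open>Minimality of A closes the chain A' \<subseteq> B \<subseteq> A found below:
    primes containing a product contain a factor, which leads from A to some B and from B back to
    some A' in \<open>As\<close>.\<close>
  have "finite (set As)" "set As \<noteq> {}" using Suc by auto
  then obtain A where A: "A \<in> set As" and min: "\<And>A'. A' \<in> set As \<Longrightarrow> A' \<subseteq> A \<Longrightarrow> A' = A"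
    using finite_has_minimal[of "set As"] by metis
  have pA: "primeideal A R" "p \<subseteq> A" using A Suc by auto
  have "ideal_list_prod R Bs \<subseteq> ideal_list_prod R As <+> p"
    using Suc set_add_upper(1)[OF ideal_list_prod_ideal[OF iB] p] by simp
  also have "\<dots> \<subseteq> A"
    using pA A iA ideal_list_prod_subset[OF iA A] by (intro set_add_least) auto
  finally obtain B where B: "B \<in> set Bs" "B \<subseteq> A"
    using prime_contains_factor[OF pA(1) iB] by blast
  then have pB: "primeideal B R" "p \<subseteq> B" using Suc by auto
  have "ideal_list_prod R As \<subseteq> ideal_list_prod R Bs <+> p"
    using Suc set_add_upper(1)[OF ideal_list_prod_ideal[OF iA] p] by simp
  also have "\<dots> \<subseteq> B"
    using pB B iB ideal_list_prod_subset[OF iB B(1)] by (intro set_add_least) auto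
  finally obtain A' where "A' \<in> set As" "A' \<subseteq> B"
    using prime_contains_factor[OF pB(1) iA] by blast
  then have AB: "A = B" using min B by blast
  define As' Bs' where "As' = remove1 A As" and "Bs' = remove1 A Bs"
  have sub: "set As' \<subseteq> set As" "set Bs' \<subseteq> set Bs"
    by (auto simp: As'_def Bs'_def dest: set_remove1_subset[THEN subsetD])
  have As: "ideal_list_prod R As = A \<cdot> ideal_list_prod R As'"
    unfolding As'_def using iA A by (rule ideal_list_prod_remove1)
  have Bs: "ideal_list_prod R Bs = A \<cdot> ideal_list_prod R Bs'"
    unfolding Bs'_def using iB B AB by (intro ideal_list_prod_remove1) auto
  have id': "ideal (ideal_list_prod R As') R" "ideal (ideal_list_prod R Bs') R"
    using sub iA iB by (auto intro!: ideal_list_prod_ideal)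
  have idAs: "ideal (A \<cdot> ideal_list_prod R As') R" "ideal (A \<cdot> ideal_list_prod R Bs') R"
    using id' iA A ideal_prod_is_ideal by auto
  have le1: "ideal_list_prod R As' \<subseteq> ideal_list_prod R Bs' <+> p"
    using Suc.prems(3)[OF A id'] Suc.prems(4) set_add_upper(1)[OF idAs(1) p] unfolding As Bs by auto
  have le2: "ideal_list_prod R Bs' \<subseteq> ideal_list_prod R As' <+> p"
    using Suc.prems(3)[OF A id'(2,1)] Suc.prems(4) set_add_upper(1)[OF idAs(2) p] unfolding As Bs by auto
  have eq: "ideal_list_prod R As' <+> p = ideal_list_prod R Bs' <+> p"
  proof
    show "ideal_list_prod R As' <+> p \<subseteq> ideal_list_prod R Bs' <+> p"
      using le1 add_ideals[OF id'(2) p] set_add_upper[OF id'(2) p] by (intro set_add_least)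
    show "ideal_list_prod R Bs' <+> p \<subseteq> ideal_list_prod R As' <+> p"
      using le2 add_ideals[OF id'(1) p] set_add_upper[OF id'(1) p] by (intro set_add_least)
  qed
  have "ideal_list_prod R As' = ideal_list_prod R Bs'"
  proof (rule Suc.hyps(1))
    show "n = length As'" using Suc A by (simp add: As'_def length_remove1)
    show "\<And>A I J. A \<in> set As' \<Longrightarrow> ideal I R \<Longrightarrow> ideal J R \<Longrightarrow> A \<cdot> I \<subseteq> A \<cdot> J <+> p \<Longrightarrow> I \<subseteq> J <+> p"
      using Suc.prems(3) sub by blast
  qed (use Suc sub eq in auto)
  then show ?case using As Bs by simp
qed

end

section \<open>Cancellation of primes\<close>

context dedekind_domain
begin

text \<open>The empty product covers the unit ideal, so later uses need no separate proper
  case.\<close>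

lemma ideal_factorization:
  assumes "ideal I R" "I \<noteq> {\<zero>}"
  obtains Ps where "\<forall>A \<in> set Ps. primeideal A R" "I = ideal_list_prod R Ps"
    "\<And>A. A \<in> set Ps \<Longrightarrow> I \<subseteq> A"
proof -
  have "\<exists>Ps. (\<forall>A \<in> set Ps. primeideal A R) \<and> I = ideal_list_prod R Ps"
  proof (cases "I = carrier R")
    case True
    then show ?thesis by (intro exI[of _ "[]"]) simp
  next
    case False
    then show ?thesis using prime_ideal_factorization assms by blast
  qed
  then obtain Ps where Ps: "\<forall>A \<in> set Ps. primeideal A R" "I = ideal_list_prod R Ps"
    by blast
  moreover have "I \<subseteq> A" if "A \<in> set Ps" for A
    using Ps that ideal_list_prod_subset[of Ps A] by (auto dest: primeideal.axioms)
  ultimately show thesis using that by blast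
qed

text \<open>For \<open>b\<close> in a larger proper ideal but not in \<open>p\<close>, the ideals \<open>(p + (b))\<^sup>2\<close> and \<open>p + (b\<^sup>2)\<close> agree modulo
  \<open>p\<close>, so unique factorization modulo \<open>p\<close> makes them equal. Hence \<open>p \<subseteq> (p + (b))\<^sup>2\<close>, which forces
  \<open>p = p \<cdot> (p + (b))\<close>, against cancellability.\<close>

lemma cancellable_prime_maximal:
  assumes p: "primeideal p R" "p \<noteq> {\<zero>}"
    and cancel: "\<And>I J. ideal I R \<Longrightarrow> ideal J R \<Longrightarrow> p \<cdot> I \<subseteq> p \<cdot> J \<Longrightarrow> I \<subseteq> J"
    and P: "ideal P R" "P \<noteq> carrier R" "p \<subseteq> P"
  shows "p = P"
proof (rule ccontr)
  assume "p \<noteq> P"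
  then obtain b where b: "b \<in> P" "b \<notin> p" using P by blast
  have ip: "ideal p R" using p by (blast dest: primeideal.axioms)
  have bc: "b \<in> carrier R" using b P by (blast dest: ideal.Icarr)
  have bb: "b \<otimes> b \<in> carrier R" "b \<otimes> b \<notin> p"
    using bc b primeideal.I_prime[OF p(1), of b b] by auto
  define J where "J = p <+> PIdl b"
  define K where "K = p <+> PIdl (b \<otimes> b)"
  have ib: "ideal (PIdl b) R" "ideal (PIdl (b \<otimes> b)) R"
    using bc bb cgenideal_ideal by auto
  have iJ: "ideal J R" and iK: "ideal K R"
    unfolding J_def K_def using ip ib add_ideals by auto
  have pJ: "p \<subseteq> J" "b \<in> J" and pK: "p \<subseteq> K" "b \<otimes> b \<in> K"
    unfolding J_def K_def using set_add_upper[OF ip] ib bc bb cgenideal_self by blast+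
  have JP: "J \<subseteq> P"
    unfolding J_def using P b by (intro set_add_least cgenideal_minimal)
  have nz: "J \<noteq> {\<zero>}" "K \<noteq> {\<zero>}"
    using pJ pK p ideal_zero[OF ip] by auto
  obtain As where As: "\<forall>A \<in> set As. primeideal A R" "J = ideal_list_prod R As"
    "\<And>A. A \<in> set As \<Longrightarrow> J \<subseteq> A"
    using ideal_factorization[OF iJ nz(1)] by metis
  obtain Bs where Bs: "\<forall>B \<in> set Bs. primeideal B R" "K = ideal_list_prod R Bs"
    "\<And>B. B \<in> set Bs \<Longrightarrow> K \<subseteq> B"
    using ideal_factorization[OF iK nz(2)] by metis
  have iAs: "\<forall>A \<in> set As. ideal A R" using As by (auto dest: primeideal.axioms)
  have iJJ: "ideal (J \<cdot> J) R" using iJ ideal_prod_is_ideal by blast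
  have bbJJ: "b \<otimes> b \<in> J \<cdot> J" using pJ by (auto intro: ideal_prod.prod)
  have JJ: "J \<cdot> J = ideal_list_prod R (As @ As)"
    using As iAs by (simp add: ideal_list_prod_append del: foldr_append)
  have "J \<cdot> J <+> p = K <+> p"
  proof
    show "K <+> p \<subseteq> J \<cdot> J <+> p"
      unfolding K_def using set_add_upper[OF iJJ ip] bbJJ add_ideals[OF iJJ ip]
      by (intro set_add_least cgenideal_minimal) auto
    have "J \<cdot> J \<subseteq> K"
    proof
      fix t assume "t \<in> J \<cdot> J"
      then obtain q y where qy: "q \<in> p \<cdot> J" "y \<in> J" "t = q \<oplus> b \<otimes> y"
        using prod_with_principal_sum[OF ip bc iJ] unfolding J_def[symmetric] by blast
      obtain q' r where y: "q' \<in> p" "r \<in> carrier R" "y = q' \<oplus> r \<otimes> b"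
        using qy(2) unfolding J_def by (metis set_add_memE cgenideal_memE)
      have qc: "q \<in> p" "q \<in> carrier R" "q' \<in> carrier R"
        using ideal_prod_inter[OF ip iJ] qy y ip by (auto dest: ideal.Icarr)
      have "t = (q \<oplus> b \<otimes> q') \<oplus> r \<otimes> (b \<otimes> b)"
        unfolding qy(3) y(3) using qc y bc by algebra
      moreover have "q \<oplus> b \<otimes> q' \<in> K"
        using pK(1) ideal_add[OF ip qc(1) ideal.I_l_closed[OF ip y(1) bc]] by blast
      moreover have "r \<otimes> (b \<otimes> b) \<in> K"
        using pK y ideal.I_l_closed[OF iK] by blast
      ultimately show "t \<in> K" using ideal_add[OF iK] by simp
    qed
    then show "J \<cdot> J <+> p \<subseteq> K <+> p"
      using set_add_upper[OF iK ip] add_ideals[OF iK ip] by (intro set_add_least) auto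
  qed
  \<comment> \<open>Each prime factor of \<open>J\<close> divides p + (b), so it can be cancelled
    modulo p.\<close>
  moreover have "I \<subseteq> I' <+> p"
    if "A \<in> set (As @ As)" "ideal I R" "ideal I' R" "A \<cdot> I \<subseteq> A \<cdot> I' <+> p" for A I I'
  proof (rule cancel_factor[OF p(1) bc b(2)])
    show "A \<cdot> ideal_list_prod R (remove1 A As) = p <+> PIdl b"
      using As(2) ideal_list_prod_remove1[OF iAs] that by (simp add: J_def)
    show "ideal (ideal_list_prod R (remove1 A As)) R"
      using iAs by (auto intro!: ideal_list_prod_ideal dest: set_remove1_subset[THEN subsetD])
  qed (use that iAs in auto)
  moreover have "\<forall>A \<in> set (As @ As). primeideal A R \<and> p \<subseteq> A"
    "\<forall>B \<in> set Bs. primeideal B R \<and> p \<subseteq> B"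
    using As(1,3) Bs(1,3) pJ(1) pK(1) by (auto dest!: subsetD)
  ultimately have "J \<cdot> J = K"
    unfolding JJ Bs(2) by (intro prime_factors_unique_mod[OF ip])
  then have pJJ: "p \<subseteq> J \<cdot> J" using pK by simp
  \<comment> \<open>Writing x in p as q + b y with q in \<open>p \<cdot> J\<close> puts b y, hence
    y, into p; as b is in \<open>J\<close>, the summand b y lies in \<open>p \<cdot> J\<close>
    too.\<close>
  have "p \<cdot> carrier R \<subseteq> p \<cdot> J"
  proof
    fix x assume "x \<in> p \<cdot> carrier R"
    then have x: "x \<in> p" using ideal_prod_one[OF ip] by simp
    obtain q y where qy: "q \<in> p \<cdot> J" "y \<in> J" "x = q \<oplus> b \<otimes> y"
      using x pJJ prod_with_principal_sum[OF ip bc iJ] unfolding J_def[symmetric] by blast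
    have q: "q \<in> p" using qy ideal_prod_inter[OF ip iJ] by blast
    have c: "x \<in> carrier R" "q \<in> carrier R" "y \<in> carrier R"
      using x q qy ip iJ by (auto dest: ideal.Icarr)
    have "b \<otimes> y = x \<ominus> q" unfolding qy(3) using c bc by algebra
    then have "b \<otimes> y \<in> p" using x q ideal_minus[OF ip] by simp
    then have "y \<in> p" using primeideal.I_prime[OF p(1) bc c(3)] b by blast
    then have "y \<otimes> b \<in> p \<cdot> J" using pJ by (auto intro: ideal_prod.prod)
    then show "x \<in> p \<cdot> J"
      unfolding qy(3) using qy(1) c bc by (simp add: m_comm[of b] ideal_prod.sum)
  qed
  then have "carrier R \<subseteq> J" using cancel[OF oneideal iJ] by blast
  then show False using JP P by (meson ideal.Icarr subsetI subset_antisym subset_trans)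
qed

text \<open>For a nonzero x in \<open>P\<close>, the prime \<open>P\<close> contains some prime
  factor p of (x). Being a factor of a principal ideal, p can be cancelled, so p is maximal and
  equals \<open>P\<close>.\<close>

lemma prime_cancel:
  assumes P: "primeideal P R" "P \<noteq> {\<zero>}"
    and "ideal I R" "ideal J R" "P \<cdot> I \<subseteq> P \<cdot> J"
  shows "I \<subseteq> J"
proof -
  have iP: "ideal P R" using P by (blast dest: primeideal.axioms)
  have zero_plus: "I <+> {\<zero>} = I" "{\<zero>} <+> I = I" if "ideal I R" for I
    using that by (force simp: set_add_def' dest: ideal.Icarr)+
  obtain x where x: "x \<in> P" "x \<noteq> \<zero>" using P ideal_zero[OF iP] by blast
  have xc: "x \<in> carrier R" using x iP by (blast dest: ideal.Icarr)
  have ix: "ideal (PIdl x) R" "PIdl x \<noteq> {\<zero>}"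
    using cgenideal_ideal[OF xc] cgenideal_self[OF xc] x by auto
  obtain Ps where Ps: "\<forall>A \<in> set Ps. primeideal A R" "PIdl x = ideal_list_prod R Ps"
    "\<And>A. A \<in> set Ps \<Longrightarrow> PIdl x \<subseteq> A"
    using ideal_factorization[OF ix] by metis
  have iPs: "\<forall>A \<in> set Ps. ideal A R" using Ps by (auto dest: primeideal.axioms)
  have "PIdl x \<subseteq> P" using iP x(1) by (rule cgenideal_minimal)
  then obtain p where p: "p \<in> set Ps" "p \<subseteq> P"
    using prime_contains_factor[OF P(1) iPs] Ps by auto
  \<comment> \<open>The ring is read here as R modulo the zero ideal, which is prime in a
    domain.\<close>
  have cancel: "I \<subseteq> J" if "ideal I R" "ideal J R" "p \<cdot> I \<subseteq> p \<cdot> J" for I J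
  proof -
    have "I \<subseteq> J <+> {\<zero>}"
    proof (rule cancel_factor[OF zeroprimeideal xc])
      show "p \<cdot> ideal_list_prod R (remove1 p Ps) = {\<zero>} <+> PIdl x"
        using Ps(2) ideal_list_prod_remove1[OF iPs p(1)] ix by (simp add: zero_plus)
      show "ideal (ideal_list_prod R (remove1 p Ps)) R"
        using iPs by (auto intro!: ideal_list_prod_ideal dest: set_remove1_subset[THEN subsetD])
      show "p \<cdot> I \<subseteq> p \<cdot> J <+> {\<zero>}"
        using that iPs p ideal_prod_is_ideal by (simp add: zero_plus)
    qed (use that iPs p x in auto)
    then show ?thesis using that by (simp add: zero_plus)
  qed
  have "p = P"
  proof (rule cancellable_prime_maximal)
    show "p \<noteq> {\<zero>}" using Ps(3)[OF p(1)] cgenideal_self[OF xc] x by auto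
    show "P \<noteq> carrier R" using primeideal.I_notcarr[OF P(1)] by simp
  qed (use Ps p iP cancel in auto)
  then show ?thesis using cancel assms by blast
qed

end

section \<open>Quotients by powers of a prime\<close>

lemma carrier_quotient: "carrier (R Quot I) = (\<lambda>a. I +>\<^bsub>R\<^esub> a) ` carrier R"
  by (auto simp: FactRing_def A_RCOSETS_def')

lemma quotient_zero: "\<zero>\<^bsub>R Quot I\<^esub> = I"
  by (simp add: FactRing_def)

text \<open>A coset is a set of ring elements, so any member represents it. A fixed choice allows
  explicit formulas for maps out of a quotient.\<close>

definition coset_rep :: "'a set \<Rightarrow> 'a"
  where "coset_rep A = (SOME a. a \<in> A)"

context cring
begin

lemma quotient_cring: "ideal I R \<Longrightarrow> cring (R Quot I)"
  using ideal.quotient_is_cring is_cring by blast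

lemma coset_eq_iff:
  assumes "ideal I R" "a \<in> carrier R" "b \<in> carrier R"
  shows "I +> a = I +> b \<longleftrightarrow> a \<ominus> b \<in> I"
  using quotient_eq_iff_same_a_r_cos[OF assms] by simp

lemma coset_minus:
  assumes "ideal I R" "a \<in> carrier R" "b \<in> carrier R"
  shows "(I +> a) \<ominus>\<^bsub>R Quot I\<^esub> (I +> b) = I +> (a \<ominus> b)"
proof -
  interpret ring_hom_ring R "R Quot I" "(+>) I"
    using assms(1) by (rule ideal.rcos_ring_hom_ring)
  show ?thesis using assms by (simp add: a_minus_def)
qed

text \<open>As a congruence in R, being a unit can be compared between ideals by mere inclusion,
  without maps between their quotients.\<close>

lemma coset_unit_iff:
  assumes "ideal I R" "a \<in> carrier R"
  shows "I +> a \<in> Units (R Quot I) \<longleftrightarrow> (\<exists>c \<in> carrier R. a \<otimes> c \<ominus> \<one> \<in> I)"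
proof -
  interpret Q: cring "R Quot I" using assms(1) by (rule quotient_cring)
  interpret ring_hom_ring R "R Quot I" "(+>) I"
    using assms(1) by (rule ideal.rcos_ring_hom_ring)
  have "I +> a \<in> Units (R Quot I) \<longleftrightarrow>
      (\<exists>c \<in> carrier R. (I +> a) \<otimes>\<^bsub>R Quot I\<^esub> (I +> c) = \<one>\<^bsub>R Quot I\<^esub>)"
  proof
    assume "I +> a \<in> Units (R Quot I)"
    then obtain x where "x \<in> carrier (R Quot I)" "(I +> a) \<otimes>\<^bsub>R Quot I\<^esub> x = \<one>\<^bsub>R Quot I\<^esub>"
      unfolding Units_def by blast
    then show "\<exists>c \<in> carrier R. (I +> a) \<otimes>\<^bsub>R Quot I\<^esub> (I +> c) = \<one>\<^bsub>R Quot I\<^esub>"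
      by (auto simp: carrier_quotient)
  next
    assume "\<exists>c \<in> carrier R. (I +> a) \<otimes>\<^bsub>R Quot I\<^esub> (I +> c) = \<one>\<^bsub>R Quot I\<^esub>"
    then obtain c where c: "c \<in> carrier R" "(I +> a) \<otimes>\<^bsub>R Quot I\<^esub> (I +> c) = \<one>\<^bsub>R Quot I\<^esub>"
      by blast
    then show "I +> a \<in> Units (R Quot I)"
      using Q.m_comm[OF hom_closed[OF assms(2)] hom_closed[OF c(1)]] hom_closed[OF assms(2)]
        hom_closed[OF c(1)]
      unfolding Units_def by auto
  qed
  also have "\<dots> \<longleftrightarrow> (\<exists>c \<in> carrier R. I +> (a \<otimes> c) = I +> \<one>)"
    using assms(2) hom_mult hom_one by (intro bex_cong) auto
  also have "\<dots> \<longleftrightarrow> (\<exists>c \<in> carrier R. a \<otimes> c \<ominus> \<one> \<in> I)"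
    by (intro bex_cong refl coset_eq_iff) (use assms in auto)
  finally show ?thesis .
qed

lemma coset_rep:
  assumes "ideal I R" "A \<in> carrier (R Quot I)"
  shows "coset_rep A \<in> carrier R" "I +> coset_rep A = A"
proof -
  interpret ideal I R by fact
  obtain a where a: "a \<in> carrier R" "A = I +> a"
    using assms(2) by (auto simp: carrier_quotient)
  have "a \<in> A" using a a_rcos_self by blast
  then have rep: "coset_rep A \<in> A" unfolding coset_rep_def by (rule someI)
  then show "coset_rep A \<in> carrier R"
    using a a_elemrcos_carrier by blast
  show "I +> coset_rep A = A"
    using rep a a_repr_independence' by blast
qed

text \<open>Chosen representatives compute the projection from R/I to R/J correctly: two members of
  one coset of \<open>I\<close> differ by an element of \<open>J\<close>.\<close>

lemma coset_rep_cong: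
  assumes "ideal I R" "ideal J R" "I \<subseteq> J" "a \<in> carrier R"
  shows "J +> coset_rep (I +> a) = J +> a"
proof -
  have "I +> a \<in> carrier (R Quot I)" using assms by (auto simp: carrier_quotient)
  note rep = coset_rep[OF assms(1) this]
  then have "coset_rep (I +> a) \<ominus> a \<in> I" using coset_eq_iff assms by blast
  then show ?thesis using coset_eq_iff rep assms by blast
qed

section \<open>Powers of an ideal and units modulo a prime power\<close>

lemma ideal_power_Suc: "ideal_power R I (Suc n) = ideal_power R I n \<cdot> I"
  by (simp add: ideal_power_def ideals_set_def)

lemma ideal_power_0: "ideal_power R I 0 = carrier R"
  by (simp add: ideal_power_def ideals_set_def)

lemma ideal_power_ideal: "ideal I R \<Longrightarrow> ideal (ideal_power R I n) R"
  by (induct n) (auto simp: ideal_power_0 ideal_power_Suc intro: oneideal ideal_prod_is_ideal)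

lemma ideal_power_1: "ideal I R \<Longrightarrow> ideal_power R I (Suc 0) = I"
  using ideal_prod_one ideal_prod_commute[OF oneideal] by (simp add: ideal_power_0 ideal_power_Suc)

lemma ideal_power_subset: "ideal I R \<Longrightarrow> n > 0 \<Longrightarrow> ideal_power R I n \<subseteq> I"
  using ideal_prod_inter[of "ideal_power R I (n - 1)" I] ideal_power_ideal[of I "n - 1"]
    ideal_power_Suc[of I "n - 1"] by auto

lemma ideal_power_antimono:
  assumes "ideal I R" "m \<le> n"
  shows "ideal_power R I n \<subseteq> ideal_power R I m"
  using assms(2)
proof (induct rule: dec_induct)
  case (step n)
  then show ?case
    using ideal_prod_inter[OF ideal_power_ideal[OF assms(1)] assms(1), of n]
    by (auto simp: ideal_power_Suc)
qed simp

lemma ideal_power_list_prod: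
  assumes "ideal I R"
  shows "ideal_list_prod R (replicate n I) = ideal_power R I n"
  by (induct n) (use assms ideal_power_ideal ideal_prod_commute in
      \<open>auto simp: ideal_power_0 ideal_power_Suc\<close>)

lemma prime_contains_power:
  assumes "primeideal P R" "ideal I R" "ideal_power R I n \<subseteq> P"
  shows "I \<subseteq> P"
  using prime_contains_factor[OF assms(1), of "replicate n I"] assms(2,3)
  by (auto simp: ideal_power_list_prod simp del: foldr_replicate)

text \<open>Multiplication by a is injective on the finite domain \<open>R Quot P\<close>, hence
  surjective, and so it reaches 1.\<close>

lemma finite_quotient_unit:
  assumes P: "primeideal P R" and fin: "finite (carrier (R Quot P))"
    and a: "a \<in> carrier R" "a \<notin> P"
  obtains c where "c \<in> carrier R" "a \<otimes> c \<ominus> \<one> \<in> P"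
proof -
  have iP: "ideal P R" using P by (rule primeideal.axioms)
  interpret Q: domain "R Quot P" using P by (rule primeideal.quotient_is_domain)
  interpret hom: ring_hom_ring R "R Quot P" "(+>) P"
    using iP by (rule ideal.rcos_ring_hom_ring)
  define f where "f = (\<lambda>x. (P +> a) \<otimes>\<^bsub>R Quot P\<^esub> x)"
  have ac: "P +> a \<in> carrier (R Quot P)" using a by simp
  have nz: "P +> a \<noteq> \<zero>\<^bsub>R Quot P\<^esub>"
    using a(2) ideal.rcos_const_imp_mem[OF iP a(1)] unfolding quotient_zero by blast
  have "inj_on f (carrier (R Quot P))"
    unfolding f_def by (rule inj_onI) (simp only: Q.m_lcancel[OF nz ac])
  moreover have "f ` carrier (R Quot P) \<subseteq> carrier (R Quot P)"
    unfolding f_def using ac by (intro image_subsetI Q.m_closed)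
  ultimately have "f ` carrier (R Quot P) = carrier (R Quot P)"
    using fin endo_inj_surj by blast
  then obtain x where x: "x \<in> carrier (R Quot P)" "f x = \<one>\<^bsub>R Quot P\<^esub>"
    using Q.one_closed by (metis imageE)
  have "P +> a \<in> Units (R Quot P)"
    using x Q.m_comm[OF ac x(1)] ac unfolding f_def Units_def mem_Collect_eq by metis
  then show thesis using that coset_unit_iff[OF iP a(1)] by blast
qed

text \<open>An element of \<open>J\<close> outside \<open>P\<close> has an inverse modulo
  \<open>P\<close>, hence modulo \<open>J\<close>; this forces 1 into \<open>J\<close>.\<close>

lemma finite_quotient_prime_maximal:
  assumes P: "primeideal P R" "finite (carrier (R Quot P))"
    and J: "ideal J R" "P \<subseteq> J" "J \<noteq> carrier R"
  shows "J = P"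
proof (rule ccontr)
  assume "J \<noteq> P"
  then obtain a where a: "a \<in> J" "a \<notin> P" using J by blast
  then have ac: "a \<in> carrier R" using J by (blast dest: ideal.Icarr)
  obtain c where c: "c \<in> carrier R" "a \<otimes> c \<ominus> \<one> \<in> P"
    using finite_quotient_unit[OF P ac a(2)] .
  have "\<one> = a \<otimes> c \<ominus> (a \<otimes> c \<ominus> \<one>)" using ac c by algebra
  moreover have "a \<otimes> c \<ominus> (a \<otimes> c \<ominus> \<one>) \<in> J"
    using a c J ideal_minus[OF J(1)] ideal.I_r_closed[OF J(1)] by blast
  ultimately show False using J ideal.one_imp_carrier by metis
qed

lemma power_quotient_unit_iff:
  assumes P: "primeideal P R" "finite (carrier (R Quot P))"
    and "n > 0" and a: "a \<in> carrier R"
  shows "ideal_power R P n +> a \<in> Units (R Quot ideal_power R P n) \<longleftrightarrow> a \<notin> P"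
proof -
  have iP: "ideal P R" using P(1) by (rule primeideal.axioms)
  have iPn: "ideal (ideal_power R P n) R" for n using iP by (rule ideal_power_ideal)
  have "(\<exists>c \<in> carrier R. a \<otimes> c \<ominus> \<one> \<in> ideal_power R P n) \<longleftrightarrow> a \<notin> P"
  proof
    assume "\<exists>c \<in> carrier R. a \<otimes> c \<ominus> \<one> \<in> ideal_power R P n"
    then obtain c where c: "c \<in> carrier R" "a \<otimes> c \<ominus> \<one> \<in> P"
      using ideal_power_subset[OF iP \<open>n > 0\<close>] by blast
    show "a \<notin> P"
    proof
      assume "a \<in> P"
      have "\<one> = a \<otimes> c \<ominus> (a \<otimes> c \<ominus> \<one>)" using a c by algebra
      moreover have "a \<otimes> c \<ominus> (a \<otimes> c \<ominus> \<one>) \<in> P"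
        using \<open>a \<in> P\<close> c ideal_minus[OF iP] ideal.I_r_closed[OF iP] by blast
      ultimately show False using primeideal.I_notcarr[OF P(1)] ideal.one_imp_carrier[OF iP] by metis
    qed
  next
    assume "a \<notin> P"
    then obtain c where c: "c \<in> carrier R" "a \<otimes> c \<ominus> \<one> \<in> P"
      using finite_quotient_unit[OF P a] by blast
    show "\<exists>c \<in> carrier R. a \<otimes> c \<ominus> \<one> \<in> ideal_power R P n"
    proof (induct n)
      case 0
      then show ?case using a by (auto simp: ideal_power_0)
    next
      case (Suc n)
      then obtain d where d: "d \<in> carrier R" "a \<otimes> d \<ominus> \<one> \<in> ideal_power R P n" by blast
      \<comment> \<open>The inverse is lifted one power at a time: the error of d in P^n and the
        error of c in P multiply into P^(n+1), and expanding the negated product displays the next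
        inverse d + c - a c d.\<close>
      have "\<ominus> ((a \<otimes> d \<ominus> \<one>) \<otimes> (a \<otimes> c \<ominus> \<one>)) \<in> ideal_power R P (Suc n)"
        unfolding ideal_power_Suc using c d iP iPn ideal_prod_is_ideal
        by (auto intro!: ideal_neg ideal_prod.prod)
      moreover have "\<ominus> ((a \<otimes> d \<ominus> \<one>) \<otimes> (a \<otimes> c \<ominus> \<one>)) = a \<otimes> (d \<oplus> c \<ominus> a \<otimes> c \<otimes> d) \<ominus> \<one>"
        using a c d by algebra
      ultimately show ?case using a c d by (intro bexI[of _ "d \<oplus> c \<ominus> a \<otimes> c \<otimes> d"]) auto
    qed
  qed
  then show ?thesis using coset_unit_iff[OF iPn a] by simp
qed

end

section \<open>Successive quotients of the powers of a prime\<close>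

context dedekind_domain
begin

lemma ideal_power_strict:
  assumes P: "primeideal P R" "P \<noteq> {\<zero>}"
  shows "\<not> ideal_power R P n \<subseteq> ideal_power R P (Suc n)"
proof (induct n)
  case 0
  have "ideal P R" using P(1) by (rule primeideal.axioms)
  then show ?case
    using primeideal.I_notcarr[OF P(1)] ideal.Icarr
    by (auto simp: ideal_power_1) (auto simp: ideal_power_0)
next
  case (Suc n)
  have iP: "ideal P R" using P(1) by (rule primeideal.axioms)
  have comm: "ideal_power R P (Suc k) = P \<cdot> ideal_power R P k" for k
    using ideal_prod_commute[OF ideal_power_ideal[OF iP] iP] by (simp add: ideal_power_Suc)
  show ?case
    using prime_cancel[OF P ideal_power_ideal[OF iP] ideal_power_ideal[OF iP]] Suc
    by (metis comm)
qed

text \<open>A prime factor of \<open>I\<close> contains P^(n+1), hence \<open>P\<close>, and equals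
  \<open>P\<close> by maximality. So \<open>I\<close> is a power of \<open>P\<close>, and not lying
  in P^(n+1) bounds its exponent by n.\<close>

lemma no_ideal_between_powers:
  assumes P: "primeideal P R" "P \<noteq> {\<zero>}" "finite (carrier (R Quot P))"
    and I: "ideal I R" "ideal_power R P (Suc n) \<subseteq> I" "I \<subseteq> ideal_power R P n"
      "\<not> I \<subseteq> ideal_power R P (Suc n)"
  shows "I = ideal_power R P n"
proof -
  have iP: "ideal P R" using P(1) by (rule primeideal.axioms)
  have "I \<noteq> {\<zero>}"
    using I ideal_zero[OF ideal_power_ideal[OF iP]] by auto
  then obtain Ps where Ps: "\<forall>A \<in> set Ps. primeideal A R" "I = ideal_list_prod R Ps"
    "\<And>A. A \<in> set Ps \<Longrightarrow> I \<subseteq> A"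
    using ideal_factorization[OF I(1)] by metis
  have "A = P" if A: "A \<in> set Ps" for A
  proof (rule finite_quotient_prime_maximal[OF P(1,3)])
    show "ideal A R" using Ps A by (auto dest: primeideal.axioms)
    have "ideal_power R P (Suc n) \<subseteq> A" using I Ps(3)[OF A] by simp
    then show "P \<subseteq> A" using prime_contains_power iP Ps(1) A by blast
    show "A \<noteq> carrier R" using Ps(1) A primeideal.I_notcarr by metis
  qed
  then have "Ps = replicate (length Ps) P" by (simp add: replicate_eqI)
  then have I_eq: "I = ideal_power R P (length Ps)"
    using Ps(2) ideal_power_list_prod[OF iP] by metis
  have "length Ps \<le> n"
    using I(4) ideal_power_antimono[OF iP, of "Suc n" "length Ps"] unfolding I_eq by (meson not_less_eq_eq)
  then show ?thesis
    using I(3) ideal_power_antimono[OF iP] unfolding I_eq by (simp add: subset_antisym)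
qed

text \<open>Multiplication by x induces an isomorphism from R/P onto P^n/P^(n+1). Any x in P^n
  outside P^(n+1) works: with P^(n+1) it generates P^n because no ideal lies in between, and an r
  outside \<open>P\<close> is invertible modulo \<open>P\<close>, so r x in P^(n+1) would put x
  there.\<close>

lemma power_step_generator:
  assumes P: "primeideal P R" "P \<noteq> {\<zero>}" "finite (carrier (R Quot P))"
  obtains x where "x \<in> ideal_power R P n"
    "\<And>r. r \<in> carrier R \<Longrightarrow> r \<otimes> x \<in> ideal_power R P (Suc n) \<longleftrightarrow> r \<in> P"
    "\<And>y. y \<in> ideal_power R P n \<Longrightarrow>
      \<exists>r \<in> carrier R. y \<ominus> r \<otimes> x \<in> ideal_power R P (Suc n)"
proof -
  have iP: "ideal P R" using P(1) by (rule primeideal.axioms)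
  have iPn: "ideal (ideal_power R P n) R" for n using iP by (rule ideal_power_ideal)
  have mono: "ideal_power R P (Suc n) \<subseteq> ideal_power R P n"
    using ideal_power_antimono[OF iP] by simp
  obtain x where x: "x \<in> ideal_power R P n" "x \<notin> ideal_power R P (Suc n)"
    using ideal_power_strict[OF P(1,2)] by blast
  have xc: "x \<in> carrier R" using x iPn by (blast dest: ideal.Icarr)
  have ix: "ideal (PIdl x) R" using xc by (rule cgenideal_ideal)
  have gen: "PIdl x <+> ideal_power R P (Suc n) = ideal_power R P n"
  proof (rule no_ideal_between_powers[OF P])
    show "ideal (PIdl x <+> ideal_power R P (Suc n)) R"
      using ix iPn by (rule add_ideals)
    show "ideal_power R P (Suc n) \<subseteq> PIdl x <+> ideal_power R P (Suc n)"
      using ix iPn by (rule set_add_upper)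
    show "PIdl x <+> ideal_power R P (Suc n) \<subseteq> ideal_power R P n"
      using iPn mono cgenideal_minimal[OF iPn x(1)] by (intro set_add_least)
    show "\<not> PIdl x <+> ideal_power R P (Suc n) \<subseteq> ideal_power R P (Suc n)"
      using set_add_upper(1)[OF ix iPn] cgenideal_self[OF xc] x(2) by blast
  qed
  show thesis
  proof (rule that[OF x(1)])
    fix y assume "y \<in> ideal_power R P n"
    then obtain r z where rz: "r \<in> carrier R" "z \<in> ideal_power R P (Suc n)" "y = r \<otimes> x \<oplus> z"
      unfolding gen[symmetric] by (metis set_add_memE cgenideal_memE)
    have zc: "z \<in> carrier R" using rz(2) iPn by (blast dest: ideal.Icarr)
    have "y \<ominus> r \<otimes> x = z"
      unfolding rz(3) using rz(1) xc zc by algebra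
    then show "\<exists>r \<in> carrier R. y \<ominus> r \<otimes> x \<in> ideal_power R P (Suc n)"
      using rz(1,2) by metis
  next
    fix r assume r: "r \<in> carrier R"
    show "r \<otimes> x \<in> ideal_power R P (Suc n) \<longleftrightarrow> r \<in> P"
    proof
      assume "r \<in> P"
      then have "x \<otimes> r \<in> ideal_power R P (Suc n)"
        using x(1) by (auto simp: ideal_power_Suc intro: ideal_prod.prod)
      then show "r \<otimes> x \<in> ideal_power R P (Suc n)" using r xc by (simp add: m_comm)
    next
      assume rx: "r \<otimes> x \<in> ideal_power R P (Suc n)"
      show "r \<in> P"
      proof (rule ccontr)
        assume "r \<notin> P"
        then obtain c where c: "c \<in> carrier R" "r \<otimes> c \<ominus> \<one> \<in> P"
          using finite_quotient_unit[OF P(1,3) r] by blast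
        have "x \<otimes> (r \<otimes> c \<ominus> \<one>) \<in> ideal_power R P (Suc n)"
          using x(1) c by (auto simp: ideal_power_Suc intro: ideal_prod.prod)
        moreover have "c \<otimes> (r \<otimes> x) \<in> ideal_power R P (Suc n)"
          using rx c ideal.I_l_closed[OF iPn] by blast
        moreover have "x = c \<otimes> (r \<otimes> x) \<ominus> x \<otimes> (r \<otimes> c \<ominus> \<one>)"
          using r c xc by algebra
        ultimately show False using x(2) ideal_minus[OF iPn] by metis
      qed
    qed
  qed
qed

text \<open>A residue modulo P^(n+1) has two digits, A modulo P^n and B modulo P, and equals rep(A)
  + rep(B) x with x from the previous lemma. For n > 0 being a unit depends only on the coset of
  \<open>P\<close>, which the first digit determines; for n = 0 the first digit lives in the zero
  ring and determines nothing.\<close>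

lemma power_quotient_bij:
  assumes P: "primeideal P R" "P \<noteq> {\<zero>}" "finite (carrier (R Quot P))"
  obtains f where
    "bij_betw f (carrier (R Quot ideal_power R P n) \<times> carrier (R Quot P))
       (carrier (R Quot ideal_power R P (Suc n)))"
    "n > 0 \<Longrightarrow> bij_betw f (Units (R Quot ideal_power R P n) \<times> carrier (R Quot P))
       (Units (R Quot ideal_power R P (Suc n)))"
proof -
  have iP: "ideal P R" using P(1) by (rule primeideal.axioms)
  have iPn: "ideal (ideal_power R P n) R" for n using iP by (rule ideal_power_ideal)
  have mono: "ideal_power R P (Suc n) \<subseteq> ideal_power R P n"
    using ideal_power_antimono[OF iP] by simp
  obtain x where x: "x \<in> ideal_power R P n"
    and ann: "\<And>r. r \<in> carrier R \<Longrightarrow> r \<otimes> x \<in> ideal_power R P (Suc n) \<longleftrightarrow> r \<in> P"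
    and gen: "\<And>y. y \<in> ideal_power R P n \<Longrightarrow>
      \<exists>r \<in> carrier R. y \<ominus> r \<otimes> x \<in> ideal_power R P (Suc n)"
    using power_step_generator[OF P] by blast
  have xc: "x \<in> carrier R" using x iPn by (blast dest: ideal.Icarr)
  define g where "g = (\<lambda>(A, B). coset_rep A \<oplus> coset_rep B \<otimes> x)"
  define f where "f = (\<lambda>D. ideal_power R P (Suc n) +> g D)"
  let ?D = "carrier (R Quot ideal_power R P n) \<times> carrier (R Quot P)"
  have gc: "g D \<in> carrier R" if "D \<in> ?D" for D
    using that coset_rep(1)[OF iPn] coset_rep(1)[OF iP] xc by (auto simp: g_def)
  have g_mod: "ideal_power R P n +> g (A, B) = A" if "(A, B) \<in> ?D" for A B
  proof -
    have c: "coset_rep A \<in> carrier R" "coset_rep B \<in> carrier R"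
      using that coset_rep(1)[OF iPn] coset_rep(1)[OF iP] by auto
    have "g (A, B) \<ominus> coset_rep A = coset_rep B \<otimes> x"
      unfolding g_def prod.case using c xc by algebra
    then have "g (A, B) \<ominus> coset_rep A \<in> ideal_power R P n"
      using x c ideal.I_l_closed[OF iPn] by simp
    then have "ideal_power R P n +> g (A, B) = ideal_power R P n +> coset_rep A"
      using coset_eq_iff[OF iPn gc[OF that] c(1)] by blast
    then show ?thesis using coset_rep(2)[OF iPn] that by simp
  qed
  have inj: "inj_on f ?D"
  proof (rule inj_onI, clarify)
    fix A B A' B'
    assume D: "A \<in> carrier (R Quot ideal_power R P n)" "B \<in> carrier (R Quot P)"
      "A' \<in> carrier (R Quot ideal_power R P n)" "B' \<in> carrier (R Quot P)"
      and eq: "f (A, B) = f (A', B')"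
    have c: "coset_rep A \<in> carrier R" "coset_rep B \<in> carrier R" "coset_rep B' \<in> carrier R"
      using D coset_rep(1)[OF iPn] coset_rep(1)[OF iP] by auto
    have diff: "g (A, B) \<ominus> g (A', B') \<in> ideal_power R P (Suc n)"
      using eq coset_eq_iff[OF iPn gc gc] D unfolding f_def by blast
    then have "ideal_power R P n +> g (A, B) = ideal_power R P n +> g (A', B')"
      using mono coset_eq_iff[OF iPn gc gc] D by blast
    then have A: "A = A'" using g_mod D by simp
    have "g (A, B) \<ominus> g (A', B') = (coset_rep B \<ominus> coset_rep B') \<otimes> x"
      unfolding g_def prod.case A[symmetric] using c xc by algebra
    then have "coset_rep B \<ominus> coset_rep B' \<in> P"
      using diff ann c by simp
    then have "P +> coset_rep B = P +> coset_rep B'"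
      using coset_eq_iff[OF iP] c by blast
    then show "A = A' \<and> B = B'" using A coset_rep(2)[OF iP] D by simp
  qed
  \<comment> \<open>The generator property supplies a second digit r for the remainder a - rep(A);
    replacing r by the chosen representative of its coset changes r x by an element of
    P^(n+1).\<close>
  have surj: "\<exists>D \<in> ?D. f D = ideal_power R P (Suc n) +> a \<and> fst D = ideal_power R P n +> a"
    if a: "a \<in> carrier R" for a
  proof -
    define A where "A = ideal_power R P n +> a"
    have A: "A \<in> carrier (R Quot ideal_power R P n)" using a by (simp add: A_def carrier_quotient)
    have Ac: "coset_rep A \<in> carrier R" using coset_rep(1)[OF iPn A] .
    have "a \<ominus> coset_rep A \<in> ideal_power R P n"
      using coset_eq_iff[OF iPn a Ac] coset_rep(2)[OF iPn A] unfolding A_def by metis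
    then obtain r where r: "r \<in> carrier R"
      "a \<ominus> coset_rep A \<ominus> r \<otimes> x \<in> ideal_power R P (Suc n)"
      using gen by blast
    define B where "B = P +> r"
    have B: "B \<in> carrier (R Quot P)" using r by (simp add: B_def carrier_quotient)
    have Bc: "coset_rep B \<in> carrier R" using coset_rep(1)[OF iP B] .
    have "r \<ominus> coset_rep B \<in> P"
      using coset_eq_iff[OF iP r(1) Bc] coset_rep(2)[OF iP B] unfolding B_def by metis
    then have "(r \<ominus> coset_rep B) \<otimes> x \<in> ideal_power R P (Suc n)"
      using ann r Bc by simp
    then have "(a \<ominus> coset_rep A \<ominus> r \<otimes> x) \<oplus> (r \<ominus> coset_rep B) \<otimes> x \<in> ideal_power R P (Suc n)"
      using r ideal_add[OF iPn] by blast
    moreover have "(a \<ominus> coset_rep A \<ominus> r \<otimes> x) \<oplus> (r \<ominus> coset_rep B) \<otimes> x = a \<ominus> g (A, B)"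
      unfolding g_def prod.case using a r(1) Ac Bc xc by algebra
    ultimately have "f (A, B) = ideal_power R P (Suc n) +> a"
      using coset_eq_iff[OF iPn a gc] A B unfolding f_def by auto
    then show ?thesis using A B A_def by (intro bexI[of _ "(A, B)"]) auto
  qed
  have "f ` ?D = carrier (R Quot ideal_power R P (Suc n))"
  proof
    show "f ` ?D \<subseteq> carrier (R Quot ideal_power R P (Suc n))"
      using gc by (auto simp: f_def carrier_quotient)
    show "carrier (R Quot ideal_power R P (Suc n)) \<subseteq> f ` ?D"
      using surj by (force simp: carrier_quotient)
  qed
  then have bij: "bij_betw f ?D (carrier (R Quot ideal_power R P (Suc n)))"
    using inj by (simp add: bij_betw_def)
  moreover have "bij_betw f (Units (R Quot ideal_power R P n) \<times> carrier (R Quot P))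
      (Units (R Quot ideal_power R P (Suc n)))" if n: "n > 0"
  proof -
    \<comment> \<open>Both sides say that g D lies outside \<open>P\<close>.\<close>
    have units: "fst D \<in> Units (R Quot ideal_power R P n) \<longleftrightarrow>
        f D \<in> Units (R Quot ideal_power R P (Suc n))" if D: "D \<in> ?D" for D
    proof -
      obtain A B where AB: "D = (A, B)" by (cases D)
      have "fst D = ideal_power R P n +> g D" using g_mod D AB by simp
      then show ?thesis
        unfolding f_def using power_quotient_unit_iff[OF P(1,3)] n gc[OF D] by simp
    qed
    have sub: "Units (R Quot J) \<subseteq> carrier (R Quot J)" for J
      by (auto simp: Units_def)
    have "f ` (Units (R Quot ideal_power R P n) \<times> carrier (R Quot P)) =
        Units (R Quot ideal_power R P (Suc n))"
    proof
      show "f ` (Units (R Quot ideal_power R P n) \<times> carrier (R Quot P)) \<subseteq>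
          Units (R Quot ideal_power R P (Suc n))"
        using units sub[of "ideal_power R P n"] by fastforce
      show "Units (R Quot ideal_power R P (Suc n)) \<subseteq>
          f ` (Units (R Quot ideal_power R P n) \<times> carrier (R Quot P))"
      proof
        fix U assume U: "U \<in> Units (R Quot ideal_power R P (Suc n))"
        then have "U \<in> f ` ?D" using sub bij by (auto simp: bij_betw_def)
        then obtain D where D: "D \<in> ?D" "U = f D" by blast
        then have "fst D \<in> Units (R Quot ideal_power R P n)" using units U by blast
        then show "U \<in> f ` (Units (R Quot ideal_power R P n) \<times> carrier (R Quot P))"
          using D by auto
      qed
    qed
    moreover have "inj_on f (Units (R Quot ideal_power R P n) \<times> carrier (R Quot P))"
      using inj sub[of "ideal_power R P n"] by (meson Sigma_mono inj_on_subset order_refl)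
    ultimately show ?thesis by (simp add: bij_betw_def)
  qed
  ultimately show thesis using that by blast
qed

lemma power_quotient_card:
  assumes P: "primeideal P R" "P \<noteq> {\<zero>}" "finite (carrier (R Quot P))"
  shows "finite (carrier (R Quot ideal_power R P (Suc n)))"
    "quot_card R (ideal_power R P (Suc n)) = quot_card R P ^ Suc n"
    "quot_phi R (ideal_power R P (Suc n)) = quot_card R P ^ n * (quot_card R P - 1)"
proof -
  have iP: "ideal P R" using P(1) by (rule primeideal.axioms)
  have "finite (carrier (R Quot ideal_power R P (Suc n))) \<and>
    quot_card R (ideal_power R P (Suc n)) = quot_card R P ^ Suc n \<and>
    quot_phi R (ideal_power R P (Suc n)) = quot_card R P ^ n * (quot_card R P - 1)"
  proof (induct n)
    \<comment> \<open>The induction starts at exponent one: the zero ring at exponent zero has one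
      unit, to which the recursion for units does not apply. In R/P the units are the nonzero
      cosets.\<close>
    case 0
    have "A \<in> Units (R Quot P) \<longleftrightarrow> A \<in> carrier (R Quot P) - {P}" for A
    proof (cases "A \<in> carrier (R Quot P)")
      case True
      then obtain a where a: "a \<in> carrier R" "A = P +> a" by (auto simp: carrier_quotient)
      have "A \<in> Units (R Quot P) \<longleftrightarrow> a \<notin> P"
        using power_quotient_unit_iff[OF P(1,3) _ a(1), of "Suc 0"] by (simp add: ideal_power_1 iP a)
      also have "\<dots> \<longleftrightarrow> A \<noteq> P"
        using a a_rcos_zero[OF iP] ideal.rcos_const_imp_mem[OF iP] by blast
      finally show ?thesis using True by simp
    qed (auto simp: Units_def)
    moreover have "P \<in> carrier (R Quot P)"
      using a_rcos_zero[OF iP ideal_zero[OF iP]] by (force simp: carrier_quotient)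
    moreover from calculation(1) have "Units (R Quot P) = carrier (R Quot P) - {P}" by blast
    ultimately show ?case
      using P(3) by (simp add: ideal_power_1 iP quot_card_def quot_phi_def)
  next
    case (Suc n)
    obtain f where f:
      "bij_betw f (carrier (R Quot ideal_power R P (Suc n)) \<times> carrier (R Quot P))
         (carrier (R Quot ideal_power R P (Suc (Suc n))))"
      "bij_betw f (Units (R Quot ideal_power R P (Suc n)) \<times> carrier (R Quot P))
         (Units (R Quot ideal_power R P (Suc (Suc n))))"
      using power_quotient_bij[OF P, of "Suc n"] by blast
    show ?case
      using Suc P(3) bij_betw_finite[OF f(1)]
        bij_betw_same_card[OF f(1), symmetric] bij_betw_same_card[OF f(2), symmetric]
      by (simp add: quot_card_def quot_phi_def card_cartesian_product mult_ac)
  qed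
  then show "finite (carrier (R Quot ideal_power R P (Suc n)))"
    "quot_card R (ideal_power R P (Suc n)) = quot_card R P ^ Suc n"
    "quot_phi R (ideal_power R P (Suc n)) = quot_card R P ^ n * (quot_card R P - 1)"
    by auto
qed

end

section \<open>Strong edge colourings of unitary Cayley graphs\<close>

text \<open>Every fibre of the map to unordered pairs is {(u, v), (v, u)}, and irreflexivity makes
  these two distinct.\<close>

lemma card_unordered_pairs:
  assumes "finite D" "\<And>u v. (u, v) \<in> D \<Longrightarrow> (v, u) \<in> D" "\<And>u. (u, u) \<notin> D"
  shows "card D = 2 * card ((\<lambda>(u, v). {u, v}) ` D)"
proof -
  let ?g = "\<lambda>(u, v). {u, v}"
  have "card D = (\<Sum>e \<in> ?g ` D. card {d \<in> D. ?g d = e})"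
    using sum.image_gen[OF assms(1), of "\<lambda>_. 1 :: nat" ?g] by simp
  also have "\<dots> = (\<Sum>e \<in> ?g ` D. 2)"
  proof (rule sum.cong)
    fix e assume "e \<in> ?g ` D"
    then obtain u v where uv: "(u, v) \<in> D" "e = {u, v}" by auto
    have "{d \<in> D. ?g d = e} = {(u, v), (v, u)}"
      using uv assms(2) by (auto simp: doubleton_eq_iff)
    moreover have "u \<noteq> v" using uv assms(3) by blast
    ultimately show "card {d \<in> D. ?g d = e} = 2" by simp
  qed simp
  finally show ?thesis by simp
qed

text \<open>Renumbering the colours frees later arguments from natural numbers: an edge may be
  coloured by an edge of another graph.\<close>

lemma strong_chromatic_index_le:
  assumes "strong_edge_coloring G c" "finite (c ` edges G)"
  shows "strong_chromatic_index G \<le> card (c ` edges G)"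
proof -
  obtain h where h: "bij_betw h (c ` edges G) {0..<card (c ` edges G)}"
    using ex_bij_betw_finite_nat[OF assms(2)] by blast
  have "strong_edge_coloring G (h \<circ> c)"
    using assms(1) h unfolding strong_edge_coloring_def bij_betw_def inj_on_def by (metis comp_apply image_eqI)
  moreover have "(h \<circ> c) ` edges G \<subseteq> {..<card (c ` edges G)}"
    using h by (auto simp: bij_betw_def)
  ultimately show ?thesis
    unfolding strong_chromatic_index_def by (intro Least_le) blast
qed

lemma strong_chromatic_index_eq_card_edges:
  assumes fin: "finite (edges G)"
    and conflict: "\<And>e f. e \<in> edges G \<Longrightarrow> f \<in> edges G \<Longrightarrow> \<exists>u \<in> e. \<exists>v \<in> f. adjacent G u v"
  shows "strong_chromatic_index G = card (edges G)"
proof (rule antisym)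
  have "strong_edge_coloring G (\<lambda>e. e)" by (simp add: strong_edge_coloring_def)
  from strong_chromatic_index_le[OF this] show "strong_chromatic_index G \<le> card (edges G)"
    using fin by simp
  let ?col = "\<lambda>k. \<exists>c :: 'a set \<Rightarrow> nat. strong_edge_coloring G c \<and> c ` edges G \<subseteq> {..<k}"
  \<comment> \<open>The least number is known to be realized by a colouring only once some number
    is; numbering the edges supplies one.\<close>
  obtain h :: "'a set \<Rightarrow> nat" where h: "bij_betw h (edges G) {0..<card (edges G)}"
    using ex_bij_betw_finite_nat[OF fin] by blast
  have "strong_edge_coloring G h"
    using h unfolding strong_edge_coloring_def bij_betw_def inj_on_def by blast
  moreover have "h ` edges G \<subseteq> {..<card (edges G)}"
    using h by (simp add: bij_betw_def atLeast0LessThan)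
  ultimately have "?col (card (edges G))" by blast
  then have "?col (strong_chromatic_index G)"
    unfolding strong_chromatic_index_def by (rule LeastI[of ?col])
  then obtain c :: "'a set \<Rightarrow> nat" where c: "strong_edge_coloring G c"
    "c ` edges G \<subseteq> {..<strong_chromatic_index G}"
    by blast
  have "inj_on c (edges G)"
  proof (rule inj_onI, rule ccontr)
    fix e f assume "e \<in> edges G" "f \<in> edges G" "c e = c f" "e \<noteq> f"
    then show False
      using c(1) conflict[of e f] unfolding strong_edge_coloring_def by meson
  qed
  then show "card (edges G) \<le> strong_chromatic_index G"
    using c(2) card_inj_on_le[of c "edges G" "{..<strong_chromatic_index G}"] by simp
qed

section \<open>Adjacency and the number of edges in a unitary Cayley graph\<close>

context cring
begin

lemma coset_unit_minus_commute:
  assumes "ideal I R" "a \<in> carrier R" "b \<in> carrier R" "I +> (a \<ominus> b) \<in> Units (R Quot I)"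
  shows "I +> (b \<ominus> a) \<in> Units (R Quot I)"
proof -
  obtain c where c: "c \<in> carrier R" "(a \<ominus> b) \<otimes> c \<ominus> \<one> \<in> I"
    using assms coset_unit_iff[of I "a \<ominus> b"] by auto
  have "(b \<ominus> a) \<otimes> (\<ominus> c) \<ominus> \<one> = (a \<ominus> b) \<otimes> c \<ominus> \<one>"
    using assms(2,3) c(1) by algebra
  then have "\<exists>c \<in> carrier R. (b \<ominus> a) \<otimes> c \<ominus> \<one> \<in> I"
    using c by (intro bexI[of _ "\<ominus> c"]) auto
  then show ?thesis using assms coset_unit_iff[of I "b \<ominus> a"] by auto
qed

lemma coset_unit_not_mem:
  assumes "ideal I R" "I \<noteq> carrier R" "a \<in> carrier R" "I +> a \<in> Units (R Quot I)"
  shows "a \<notin> I"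
proof
  assume "a \<in> I"
  obtain c where c: "c \<in> carrier R" "a \<otimes> c \<ominus> \<one> \<in> I"
    using assms coset_unit_iff[of I a] by auto
  have "\<one> = a \<otimes> c \<ominus> (a \<otimes> c \<ominus> \<one>)" using assms(3) c by algebra
  moreover have "a \<otimes> c \<ominus> (a \<otimes> c \<ominus> \<one>) \<in> I"
    using \<open>a \<in> I\<close> c ideal_minus[OF assms(1)] ideal.I_r_closed[OF assms(1)] by blast
  ultimately show False using assms(1,2) ideal.one_imp_carrier by metis
qed

lemma unitary_cayley_edges:
  "edges (unitary_cayley_graph R I) =
    {{I +> a, I +> b} | a b. a \<in> carrier R \<and> b \<in> carrier R \<and> I +> (a \<ominus> b) \<in> Units (R Quot I)}"
  by (simp add: unitary_cayley_graph_def)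

text \<open>An edge may come from other representatives and list its ends in either order.
  Differences of cosets depend on the cosets only, and units are closed under negation.\<close>

lemma unitary_cayley_adjacent_iff:
  assumes I: "ideal I R" and ab: "a \<in> carrier R" "b \<in> carrier R"
  shows "adjacent (unitary_cayley_graph R I) (I +> a) (I +> b) \<longleftrightarrow>
    I +> (a \<ominus> b) \<in> Units (R Quot I)"
proof
  assume "adjacent (unitary_cayley_graph R I) (I +> a) (I +> b)"
  then obtain c d where cd: "c \<in> carrier R" "d \<in> carrier R" "I +> (c \<ominus> d) \<in> Units (R Quot I)"
    "{I +> a, I +> b} = {I +> c, I +> d}"
    unfolding adjacent_def unitary_cayley_edges by blast
  then consider "I +> a = I +> c" "I +> b = I +> d" | "I +> a = I +> d" "I +> b = I +> c"
    by (auto simp: doubleton_eq_iff)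
  then show "I +> (a \<ominus> b) \<in> Units (R Quot I)"
  proof cases
    case 1
    then have "I +> (a \<ominus> b) = I +> (c \<ominus> d)"
      using coset_minus[OF I] ab cd by metis
    then show ?thesis using cd by simp
  next
    case 2
    then have "I +> (a \<ominus> b) = I +> (d \<ominus> c)"
      using coset_minus[OF I] ab cd by metis
    then show ?thesis using coset_unit_minus_commute[OF I cd(1-3)] by simp
  qed
next
  assume "I +> (a \<ominus> b) \<in> Units (R Quot I)"
  then show "adjacent (unitary_cayley_graph R I) (I +> a) (I +> b)"
    unfolding adjacent_def unitary_cayley_edges using ab
    by (auto simp: unitary_cayley_graph_def carrier_quotient)
qed

text \<open>Every vertex u has one neighbour u - s for each unit s, and summing over u counts each
  edge from both ends. Properness of \<open>I\<close> excludes loops, as 0 is then no unit.\<close>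

lemma unitary_cayley_card_edges:
  assumes I: "ideal I R" "I \<noteq> carrier R" and fin: "finite (carrier (R Quot I))"
  shows "finite (edges (unitary_cayley_graph R I))"
    "2 * card (edges (unitary_cayley_graph R I)) = quot_card R I * quot_phi R I"
proof -
  interpret Q: cring "R Quot I" using I(1) by (rule quotient_cring)
  define D where "D = {(u, v). u \<in> carrier (R Quot I) \<and> v \<in> carrier (R Quot I) \<and>
    u \<ominus>\<^bsub>R Quot I\<^esub> v \<in> Units (R Quot I)}"
  have "D \<subseteq> carrier (R Quot I) \<times> carrier (R Quot I)"
    unfolding D_def by blast
  then have finD: "finite D" by (rule finite_subset) (intro finite_cartesian_product fin)
  have D_memE: "\<exists>a b. a \<in> carrier R \<and> b \<in> carrier R \<and> u = I +> a \<and> v = I +> b \<and>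
      I +> (a \<ominus> b) \<in> Units (R Quot I)" if "(u, v) \<in> D" for u v
  proof -
    have uv: "u \<in> carrier (R Quot I)" "v \<in> carrier (R Quot I)"
      "u \<ominus>\<^bsub>R Quot I\<^esub> v \<in> Units (R Quot I)"
      using that by (simp_all only: D_def mem_Collect_eq prod.case)
    obtain a where a: "a \<in> carrier R" "u = I +> a"
      using uv(1) unfolding carrier_quotient by (rule imageE)
    obtain b where b: "b \<in> carrier R" "v = I +> b"
      using uv(2) unfolding carrier_quotient by (rule imageE)
    have "I +> (a \<ominus> b) \<in> Units (R Quot I)"
      using uv(3) unfolding a(2) b(2) coset_minus[OF I(1) a(1) b(1)] .
    then show ?thesis using a b by metis
  qed
  have E: "edges (unitary_cayley_graph R I) = (\<lambda>(u, v). {u, v}) ` D"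
  proof
    show "edges (unitary_cayley_graph R I) \<subseteq> (\<lambda>(u, v). {u, v}) ` D"
    proof
      fix e assume "e \<in> edges (unitary_cayley_graph R I)"
      then obtain a b where ab: "a \<in> carrier R" "b \<in> carrier R" "e = {I +> a, I +> b}"
        "I +> (a \<ominus> b) \<in> Units (R Quot I)"
        unfolding unitary_cayley_edges by blast
      then have "(I +> a, I +> b) \<in> D"
        unfolding D_def carrier_quotient using coset_minus[OF I(1)] by simp
      then show "e \<in> (\<lambda>(u, v). {u, v}) ` D" using ab(3) by blast
    qed
    show "(\<lambda>(u, v). {u, v}) ` D \<subseteq> edges (unitary_cayley_graph R I)"
    proof (clarify)
      fix u v assume "(u, v) \<in> D"
      then show "{u, v} \<in> edges (unitary_cayley_graph R I)"
        unfolding unitary_cayley_edges using D_memE by blast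
    qed
  qed
  then show "finite (edges (unitary_cayley_graph R I))" using finD by simp
  have "card D = 2 * card (edges (unitary_cayley_graph R I))"
    unfolding E
  proof (rule card_unordered_pairs[OF finD])
    show "(v, u) \<in> D" if "(u, v) \<in> D" for u v
    proof -
      obtain a b where ab: "a \<in> carrier R" "b \<in> carrier R" "u = I +> a" "v = I +> b"
        "I +> (a \<ominus> b) \<in> Units (R Quot I)"
        using D_memE \<open>(u, v) \<in> D\<close> by blast
      then show ?thesis
        unfolding D_def carrier_quotient
        using coset_minus[OF I(1)] coset_unit_minus_commute[OF I(1)] by simp
    qed
    show "(u, u) \<notin> D" for u
    proof
      assume u: "(u, u) \<in> D"
      then obtain a b where ab: "a \<in> carrier R" "b \<in> carrier R" "I +> a = I +> b"
        "I +> (a \<ominus> b) \<in> Units (R Quot I)"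
        using D_memE by blast
      then have "a \<ominus> b \<in> I" using coset_eq_iff[OF I(1)] by blast
      then show False using coset_unit_not_mem[OF I _ ab(4)] ab by simp
    qed
  qed
  \<comment> \<open>The map and its inverse have the same formula because u - (u - v) = v.\<close>
  moreover have "card D = card (carrier (R Quot I) \<times> Units (R Quot I))"
  proof (rule bij_betw_same_card[OF bij_betwI[where
      f = "\<lambda>(u, v). (u, u \<ominus>\<^bsub>R Quot I\<^esub> v)" and g = "\<lambda>(u, s). (u, u \<ominus>\<^bsub>R Quot I\<^esub> s)"]])
    have inv: "u \<ominus>\<^bsub>R Quot I\<^esub> (u \<ominus>\<^bsub>R Quot I\<^esub> v) = v"
      if "u \<in> carrier (R Quot I)" "v \<in> carrier (R Quot I)" for u v
      using that by algebra
    have sub: "s \<in> carrier (R Quot I)" if "s \<in> Units (R Quot I)" for s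
      using that by (simp add: Units_def)
    show "(\<lambda>(u, v). (u, u \<ominus>\<^bsub>R Quot I\<^esub> v)) \<in> D \<rightarrow> carrier (R Quot I) \<times> Units (R Quot I)"
      by (auto simp: D_def)
    show "(\<lambda>(u, s). (u, u \<ominus>\<^bsub>R Quot I\<^esub> s)) \<in> carrier (R Quot I) \<times> Units (R Quot I) \<rightarrow> D"
      using inv sub by (auto simp: D_def)
    show "(case case d of (u, v) \<Rightarrow> (u, u \<ominus>\<^bsub>R Quot I\<^esub> v) of
        (u, s) \<Rightarrow> (u, u \<ominus>\<^bsub>R Quot I\<^esub> s)) = d" if "d \<in> D" for d
      using that inv by (auto simp: D_def)
    show "(case case d of (u, s) \<Rightarrow> (u, u \<ominus>\<^bsub>R Quot I\<^esub> s) of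
        (u, v) \<Rightarrow> (u, u \<ominus>\<^bsub>R Quot I\<^esub> v)) = d" if "d \<in> carrier (R Quot I) \<times> Units (R Quot I)" for d
      using that inv sub by auto
  qed
  ultimately show "2 * card (edges (unitary_cayley_graph R I)) = quot_card R I * quot_phi R I"
    by (simp add: quot_card_def quot_phi_def card_cartesian_product)
qed

text \<open>A single end a of e suffices: the ends of f lie in different cosets of \<open>P\<close>,
  so a shares its coset with at most one of them and is adjacent to the other.\<close>

lemma prime_power_edges_conflict:
  assumes P: "primeideal P R" "finite (carrier (R Quot P))" and n: "n > 0"
    and e: "e \<in> edges (unitary_cayley_graph R (ideal_power R P n))"
    and f: "f \<in> edges (unitary_cayley_graph R (ideal_power R P n))"
  shows "\<exists>u \<in> e. \<exists>v \<in> f. adjacent (unitary_cayley_graph R (ideal_power R P n)) u v"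
proof -
  have iP: "ideal P R" using P(1) by (rule primeideal.axioms)
  have iPn: "ideal (ideal_power R P n) R" using iP by (rule ideal_power_ideal)
  obtain a b where ab: "a \<in> carrier R" "b \<in> carrier R" "a \<ominus> b \<notin> P"
    "e = {ideal_power R P n +> a, ideal_power R P n +> b}"
    using e power_quotient_unit_iff[OF P n] unfolding unitary_cayley_edges by auto
  obtain c d where cd: "c \<in> carrier R" "d \<in> carrier R" "c \<ominus> d \<notin> P"
    "f = {ideal_power R P n +> c, ideal_power R P n +> d}"
    using f power_quotient_unit_iff[OF P n] unfolding unitary_cayley_edges by auto
  have "a \<ominus> c \<notin> P \<or> a \<ominus> d \<notin> P"
  proof (rule ccontr)
    assume "\<not> (a \<ominus> c \<notin> P \<or> a \<ominus> d \<notin> P)"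
    then have "(a \<ominus> d) \<ominus> (a \<ominus> c) \<in> P" using ideal_minus[OF iP] by blast
    moreover have "(a \<ominus> d) \<ominus> (a \<ominus> c) = c \<ominus> d" using ab cd by algebra
    ultimately show False using cd by simp
  qed
  then show ?thesis
    unfolding ab(4) cd(4)
    using unitary_cayley_adjacent_iff[OF iPn] power_quotient_unit_iff[OF P n] ab cd by auto
qed

section \<open>Products with an ideal of index two\<close>

lemma index_two_ideal:
  assumes Q: "ideal Q R" "quot_card R Q = 2"
    and ab: "a \<in> carrier R" "b \<in> carrier R" "a \<notin> Q" "b \<notin> Q"
  shows "a \<ominus> b \<in> Q"
proof (rule ccontr)
  assume ne: "a \<ominus> b \<notin> Q"
  have "Q +> a \<noteq> Q" "Q +> b \<noteq> Q" "Q +> a \<noteq> Q +> b"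
    using ab ne ideal.rcos_const_imp_mem[OF Q(1)] coset_eq_iff[OF Q(1)] by auto
  then have three: "card {Q, Q +> a, Q +> b} = 3" by auto
  have sub: "{Q, Q +> a, Q +> b} \<subseteq> carrier (R Quot Q)"
    using ab a_rcos_zero[OF Q(1) ideal_zero[OF Q(1)]] by (force simp: carrier_quotient)
  \<comment> \<open>Infinite sets have \<open>card\<close> 0, so the value 2 implies
    finiteness.\<close>
  have "finite (carrier (R Quot Q))"
    using Q(2) unfolding quot_card_def by (metis card.infinite zero_neq_numeral)
  from card_mono[OF this sub] show False using three Q(2) by (simp add: quot_card_def)
qed

text \<open>Both 1 and an m in \<open>M\<close> outside \<open>Q\<close> lie in the only nonzero
  coset of \<open>Q\<close>, so 1 - m is in \<open>Q\<close>. Thus \<open>Q\<close> and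
  \<open>M\<close> are comaximal.\<close>

lemma index_two_prod_eq_inter:
  assumes Q: "ideal Q R" "quot_card R Q = 2" "Q \<noteq> carrier R" and M: "ideal M R" "\<not> M \<subseteq> Q"
  shows "Q \<cdot> M = Q \<inter> M"
proof (rule ideal_prod_eq_inter[OF Q(1) M(1)])
  obtain m where m: "m \<in> M" "m \<notin> Q" using M by blast
  have mc: "m \<in> carrier R" using m M by (blast dest: ideal.Icarr)
  have "\<one> \<notin> Q" using Q ideal.one_imp_carrier by blast
  then have "\<one> \<ominus> m \<in> Q" using index_two_ideal[OF Q(1,2) _ mc _ m(2)] by simp
  moreover have "\<one> = (\<one> \<ominus> m) \<oplus> m" using mc by algebra
  ultimately have "\<one> \<in> Q <+> M" using m by (intro set_add_memI)
  then show "Q <+> M = carrier R" using ideal.one_imp_carrier[OF add_ideals[OF Q(1) M(1)]] by simp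
qed

text \<open>Since \<open>R Quot (Q \<cdot> M)\<close> is the product of \<open>R Quot M\<close> and the field with two elements, its graph
  is the bipartite double cover of the graph of \<open>R Quot M\<close>. Giving an edge the colour of its image
  identifies exactly the two lifts of every edge, and no endpoint of one lift is adjacent to an
  endpoint of the other.\<close>

lemma index_two_cover_strong_index_le:
  assumes Q: "ideal Q R" "quot_card R Q = 2" "Q \<noteq> carrier R"
    and M: "ideal M R" "M \<noteq> carrier R" "\<not> M \<subseteq> Q" and fin: "finite (carrier (R Quot M))"
  shows "strong_chromatic_index (unitary_cayley_graph R (Q \<cdot> M)) \<le>
    card (edges (unitary_cayley_graph R M))"
proof -
  have QM: "Q \<cdot> M = Q \<inter> M" using Q M(1,3) by (rule index_two_prod_eq_inter)
  have iQM: "ideal (Q \<cdot> M) R" using Q(1) M(1) by (rule ideal_prod_is_ideal)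
  define c where "c = (\<lambda>e. (\<lambda>C. M +> coset_rep C) ` e)"
  have c: "c {Q \<cdot> M +> a, Q \<cdot> M +> b} = {M +> a, M +> b}"
    if "a \<in> carrier R" "b \<in> carrier R" for a b
    using that coset_rep_cong[OF iQM M(1)] QM by (simp add: c_def)
  have unit: "d \<notin> Q" "M +> d \<in> Units (R Quot M)" "d \<notin> M"
    if d: "d \<in> carrier R" "Q \<cdot> M +> d \<in> Units (R Quot (Q \<cdot> M))" for d
  proof -
    obtain r where r: "r \<in> carrier R" "d \<otimes> r \<ominus> \<one> \<in> Q \<cdot> M"
      using d(2) unfolding coset_unit_iff[OF iQM d(1)] by (rule bexE)
    then have r': "d \<otimes> r \<ominus> \<one> \<in> Q" "d \<otimes> r \<ominus> \<one> \<in> M" unfolding QM by simp_all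
    show M': "M +> d \<in> Units (R Quot M)"
      unfolding coset_unit_iff[OF M(1) d(1)] using r(1) r'(2) by (rule bexI[rotated])
    have "Q +> d \<in> Units (R Quot Q)"
      unfolding coset_unit_iff[OF Q(1) d(1)] using r(1) r'(1) by (rule bexI[rotated])
    then show "d \<notin> Q" by (rule coset_unit_not_mem[OF Q(1,3) d(1)])
    show "d \<notin> M" using coset_unit_not_mem[OF M(1,2) d(1) M'] .
  qed
  have "strong_edge_coloring (unitary_cayley_graph R (Q \<cdot> M)) c"
    unfolding strong_edge_coloring_def
  proof (intro ballI impI notI, elim conjE bexE)
    fix e f u v
    assume e: "e \<in> edges (unitary_cayley_graph R (Q \<cdot> M))"
      and f: "f \<in> edges (unitary_cayley_graph R (Q \<cdot> M))" and "e \<noteq> f" and eq: "c e = c f"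
      and uv: "u \<in> e" "v \<in> f" "adjacent (unitary_cayley_graph R (Q \<cdot> M)) u v"
    \<comment> \<open>Either end of an edge may be written first, so the adjacent vertices u and v
      become the first listed ends of e and f.\<close>
    have ends: "\<exists>a b. a \<in> carrier R \<and> b \<in> carrier R \<and> w = Q \<cdot> M +> a \<and>
        g = {Q \<cdot> M +> a, Q \<cdot> M +> b} \<and> Q \<cdot> M +> (a \<ominus> b) \<in> Units (R Quot (Q \<cdot> M))"
      if "g \<in> edges (unitary_cayley_graph R (Q \<cdot> M))" "w \<in> g" for g w
      using that coset_unit_minus_commute[OF iQM] unfolding unitary_cayley_edges
      by (auto simp: doubleton_eq_iff; blast)
    obtain a b where ab: "a \<in> carrier R" "b \<in> carrier R" "u = Q \<cdot> M +> a"
      "e = {Q \<cdot> M +> a, Q \<cdot> M +> b}" "Q \<cdot> M +> (a \<ominus> b) \<in> Units (R Quot (Q \<cdot> M))"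
      using ends[OF e uv(1)] by blast
    obtain b' a' where ab': "b' \<in> carrier R" "a' \<in> carrier R" "v = Q \<cdot> M +> b'"
      "f = {Q \<cdot> M +> b', Q \<cdot> M +> a'}" "Q \<cdot> M +> (b' \<ominus> a') \<in> Units (R Quot (Q \<cdot> M))"
      using ends[OF f uv(2)] by blast
    have adj: "Q \<cdot> M +> (a \<ominus> b') \<in> Units (R Quot (Q \<cdot> M))"
      using uv(3) unitary_cayley_adjacent_iff[OF iQM] ab ab' by simp
    have "{M +> a, M +> b} = {M +> b', M +> a'}"
      using eq c ab ab' by simp
    \<comment> \<open>Adjacent vertices have distinct images modulo \<open>M\<close>, which rules
      out matching a with b' and leaves a with a'.\<close>
    moreover have "M +> a \<noteq> M +> b'"
      using unit(3)[OF _ adj] coset_eq_iff[OF M(1)] ab ab' by simp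
    ultimately have M_eq: "M +> a = M +> a'" "M +> b = M +> b'"
      by (auto simp: doubleton_eq_iff)
    then have M_mem: "a \<ominus> a' \<in> M" "b \<ominus> b' \<in> M"
      using coset_eq_iff[OF M(1)] ab ab' by auto
    \<comment> \<open>Two elements outside \<open>Q\<close> differ by an element of
      \<open>Q\<close>. Applied to differences of adjacent vertices, this makes matched ends agree
      modulo \<open>Q\<close> as well as \<open>M\<close>, so e = f.\<close>
    have notQ: "a \<ominus> b \<notin> Q" "a \<ominus> b' \<notin> Q" "b' \<ominus> a' \<notin> Q"
      using unit(1) ab ab' adj by auto
    \<comment> \<open>The sign is reversed so that subtracting from a - b' leaves a - a'.\<close>
    have neg: "\<ominus> (b' \<ominus> a') \<notin> Q"
      using notQ(3) ideal_neg[OF Q(1), of "\<ominus> (b' \<ominus> a')"] ab' by auto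
    have "(a \<ominus> b') \<ominus> (a \<ominus> b) \<in> Q"
      using index_two_ideal[OF Q(1,2)] notQ ab ab' by simp
    moreover have "(a \<ominus> b') \<ominus> (a \<ominus> b) = b \<ominus> b'" using ab ab' by algebra
    ultimately have "b \<ominus> b' \<in> Q \<cdot> M" using QM M_mem by simp
    then have b: "Q \<cdot> M +> b = Q \<cdot> M +> b'" using coset_eq_iff[OF iQM] ab ab' by simp
    have "(a \<ominus> b') \<ominus> (\<ominus> (b' \<ominus> a')) \<in> Q"
      using index_two_ideal[OF Q(1,2)] notQ neg ab ab' by simp
    moreover have "(a \<ominus> b') \<ominus> (\<ominus> (b' \<ominus> a')) = a \<ominus> a'" using ab ab' by algebra
    ultimately have "a \<ominus> a' \<in> Q \<cdot> M" using QM M_mem by simp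
    then have "Q \<cdot> M +> a = Q \<cdot> M +> a'" using coset_eq_iff[OF iQM] ab ab' by simp
    then show False using b \<open>e \<noteq> f\<close> ab ab' by auto
  qed
  moreover have sub: "c ` edges (unitary_cayley_graph R (Q \<cdot> M)) \<subseteq> edges (unitary_cayley_graph R M)"
  proof
    fix g assume "g \<in> c ` edges (unitary_cayley_graph R (Q \<cdot> M))"
    then obtain a b where ab: "a \<in> carrier R" "b \<in> carrier R" "g = {M +> a, M +> b}"
      "Q \<cdot> M +> (a \<ominus> b) \<in> Units (R Quot (Q \<cdot> M))"
      unfolding unitary_cayley_edges using c by auto
    then have "M +> (a \<ominus> b) \<in> Units (R Quot M)" using unit(2) by simp
    then show "g \<in> edges (unitary_cayley_graph R M)"
      unfolding unitary_cayley_edges using ab by blast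
  qed
  moreover have finE: "finite (edges (unitary_cayley_graph R M))"
    using unitary_cayley_card_edges(1)[OF M(1,2) fin] .
  ultimately show ?thesis
    using strong_chromatic_index_le finite_subset card_mono by (meson order_trans)
qed

end

theorem theorem5p2:
  fixes R :: "('a, 'b) ring_scheme" (structure)
    and P Q M :: "'a set"
    and \<alpha> :: nat
  assumes "dedekind_domain R"
    and "primeideal P R" and "P \<noteq> {\<zero>}"
    and "primeideal Q R" and "Q \<noteq> {\<zero>}"
    and "ideal M R" and "M \<noteq> {\<zero>}"
    and "\<not> M \<subseteq> Q"
    and "finite (carrier (R Quot P))" and "carrier (R Quot P) \<noteq> {\<zero>\<^bsub>R Quot P\<^esub>}"
    and "finite (carrier (R Quot M))" and "carrier (R Quot M) \<noteq> {\<zero>\<^bsub>R Quot M\<^esub>}"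
    and "quot_card R Q = 2"
    and "\<alpha> > 0"
  shows "real (strong_chromatic_index (unitary_cayley_graph R (ideal_power R P \<alpha>)))
           = 1 / 2 * real (quot_card R P) ^ \<alpha> * real (quot_phi R (ideal_power R P \<alpha>))
       \<and> 1 / 2 * real (quot_card R P) ^ \<alpha> * real (quot_phi R (ideal_power R P \<alpha>))
           = 1 / 2 * real (quot_card R P) ^ (2 * \<alpha> - 1) * (real (quot_card R P) - 1)
       \<and> real (strong_chromatic_index (unitary_cayley_graph R (ideal_prod R Q M)))
           \<le> 1 / 2 * real (quot_card R M) * real (quot_phi R M)"
proof -
  interpret dedekind_domain R by fact
  have iP: "ideal P R" and iQ: "ideal Q R"
    using assms(2,4) by (auto dest: primeideal.axioms)
  let ?P = "ideal_power R P \<alpha>"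
  obtain n where n: "\<alpha> = Suc n"
    using assms(14) by (cases \<alpha>) auto
  note card = power_quotient_card[OF assms(2,3,9), of n, folded n]
  have "?P \<noteq> carrier R"
    using ideal_power_subset[OF iP assms(14)] primeideal.I_notcarr[OF assms(2)]
      ideal.Icarr[OF iP] by blast
  note E = unitary_cayley_card_edges[OF ideal_power_ideal[OF iP] this card(1)]
  have "strong_chromatic_index (unitary_cayley_graph R ?P) = card (edges (unitary_cayley_graph R ?P))"
    using E(1) prime_power_edges_conflict[OF assms(2,9,14)]
    by (rule strong_chromatic_index_eq_card_edges)
  then have "2 * strong_chromatic_index (unitary_cayley_graph R ?P) =
      quot_card R P ^ \<alpha> * quot_phi R ?P"
    using E(2) card(2) by simp
  then have "real (2 * strong_chromatic_index (unitary_cayley_graph R ?P)) =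
      real (quot_card R P ^ \<alpha> * quot_phi R ?P)"
    by (rule arg_cong)
  then have index_P: "real (strong_chromatic_index (unitary_cayley_graph R ?P)) =
      1 / 2 * real (quot_card R P) ^ \<alpha> * real (quot_phi R ?P)"
    by simp
  \<comment> \<open>The unit count contains a truncated subtraction, which positivity turns into a
    real one. With \<alpha> = n + 1 the exponents \<alpha> and n then add up to 2 \<alpha> -
    1.\<close>
  have "quot_card R P > 0"
    using assms(9) unfolding quot_card_def by (auto simp: card_gt_0_iff carrier_quotient)
  then have "real (quot_phi R ?P) = real (quot_card R P) ^ n * (real (quot_card R P) - 1)"
    using card(3) by (simp add: of_nat_diff)
  moreover have "2 * \<alpha> - 1 = \<alpha> + n" using n by simp
  ultimately have phi_P: "1 / 2 * real (quot_card R P) ^ \<alpha> * real (quot_phi R ?P) =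
      1 / 2 * real (quot_card R P) ^ (2 * \<alpha> - 1) * (real (quot_card R P) - 1)"
    by (simp add: power_add)
  have M: "M \<noteq> carrier R"
  proof
    assume "M = carrier R"
    then have "carrier (R Quot M) = {\<zero>\<^bsub>R Quot M\<^esub>}"
      using a_rcos_zero[OF assms(6)] unfolding carrier_quotient quotient_zero by auto
    then show False using assms(12) by contradiction
  qed
  have Q: "Q \<noteq> carrier R"
    using primeideal.I_notcarr[OF assms(4)] by simp
  have "2 * strong_chromatic_index (unitary_cayley_graph R (Q \<cdot> M)) \<le> quot_card R M * quot_phi R M"
    using index_two_cover_strong_index_le[OF iQ assms(13) Q assms(6) M assms(8,11)]
      unitary_cayley_card_edges(2)[OF assms(6) M assms(11)] by simp
  then have "real (2 * strong_chromatic_index (unitary_cayley_graph R (Q \<cdot> M))) \<le>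
      real (quot_card R M * quot_phi R M)"
    by (rule of_nat_mono)
  then have "real (strong_chromatic_index (unitary_cayley_graph R (Q \<cdot> M))) \<le>
      1 / 2 * real (quot_card R M) * real (quot_phi R M)"
    by simp
  with index_P phi_P show ?thesis by blast
qed

end
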